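(* Let $N\geq 2$, let $\Omega\subset\mathbb{R}^N$ be a smooth bounded domain, let $p,q\in(N,\infty)$ with $p\neq q$, and let $\lambda>\lambda_\infty(p)$. Every least energy solution $u\in X_{p,q}$ of $$-(\Delta_p+\Delta_q)u=\lambda|u(x_u)|^{p-2}u(x_u)\delta_{x_u}\ \text{ in }\Omega,\qquad u=0\ \text{ on }\partial\Omega$$ is a weak solution of this problem; that is, there is a point $x_u\in\Omega$ with $|u(x_u)|=\|u\|_\infty$ such that $$\int_\Omega\left(|\nabla u|^{p-2}+|\nabla u|^{q-2}\right)\nabla u\cdot\nabla v\,dx=\lambda|u(x_u)|^{p-2}u(x_u)v(x_u)\qquad\text{for all }v\in X_{p,q}.$$
   Context: $\|\cdot\|_s$ is the norm of $L^s(\Omega)$. $X_{p,q}:=W_0^{1,\max\{p,q\}}(\Omega)\hookrightarrow C(\overline\Omega)$. $(\Delta_p+\Delta_q)u:=\operatorname{div}[(|\nabla u|^{p-2}+|\nabla u|^{q-2})\nabla u]$; $x_u$ denotes a maximum point of $|u|$ and $\delta_{x_u}$ the Dirac delta supported at $x_u$. For $m>N$, $\lambda_\infty(m):=\min\{\|\nabla v\|_m^m/\|v\|_\infty^m: v\in W_0^{1,m}(\Omega)\setminus\{0\}\}$. Put $J_\lambda(u):=\frac1p\|\nabla u\|_p^p+\frac1q\|\nabla u\|_q^q-\frac{\lambda}{p}\|u\|_\infty^p$ on $X_{p,q}$ and $\mathcal N_{\lambda,\infty}:=\{u\in X_{p,q}\setminus\{0\}:\|\nabla u\|_p^p+\|\nabla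 u\|_q^q=\lambda\|u\|_\infty^p\}$. A least energy solution is a function $u\in X_{p,q}$ minimizing $J_\lambda$ over $X_{p,q}$ if $N<p<q$, or over $\mathcal N_{\lambda,\infty}$ (with $u\in\mathcal N_{\lambda,\infty}$) if $N<q<p$. *)

theory Defs
  imports "HOL-Analysis.Analysis" "HOL-Probability.Essential_Supremum"
begin

primrec Ck_on :: "nat \<Rightarrow> 'a::euclidean_space set \<Rightarrow> ('a \<Rightarrow> real) \<Rightarrow> bool" where
  "Ck_on 0 S f \<longleftrightarrow> continuous_on S f"
| "Ck_on (Suc k) S f \<longleftrightarrow>
     (\<forall>x\<in>S. f differentiable (at x)) \<and>
     (\<forall>b\<in>Basis. Ck_on k S (\<lambda>x. frechet_derivative f (at x) b))"

definition smooth_on :: "'a::euclidean_space set \<Rightarrow> ('a \<Rightarrow> real) \<Rightarrow> bool" where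
  "smooth_on S f \<longleftrightarrow> (\<forall>k. Ck_on k S f)"

text \<open>The boundary is smooth when, near each of its points, the domain is the strict sublevel
  set of a smooth function without critical points (so the boundary is a smooth hypersurface
  with the domain locally on one side of it).\<close>

definition smooth_bounded_domain :: "'a::euclidean_space set \<Rightarrow> bool" where
  "smooth_bounded_domain \<Omega> \<longleftrightarrow>
     open \<Omega> \<and> connected \<Omega> \<and> \<Omega> \<noteq> {} \<and> bounded \<Omega> \<and>
     (\<forall>x\<in>frontier \<Omega>. \<exists>U \<rho>. open U \<and> x \<in> U \<and> smooth_on U \<rho> \<and>
        (\<forall>y\<in>U. frechet_derivative \<rho> (at y) \<noteq> (\<lambda>_. 0)) \<and>
        \<Omega> \<inter> U = {y\<in>U. \<rho> y < 0})"

definition test_functions :: "'a::euclidean_space set \<Rightarrow> ('a \<Rightarrow> real) set" where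
  "test_functions \<Omega> = {\<phi>. smooth_on UNIV \<phi> \<and>
     compact (closure {x. \<phi> x \<noteq> 0}) \<and> closure {x. \<phi> x \<noteq> 0} \<subseteq> \<Omega>}"

definition locally_integrable ::
    "'a::euclidean_space set \<Rightarrow> ('a \<Rightarrow> 'b::euclidean_space) \<Rightarrow> bool" where
  "locally_integrable \<Omega> f \<longleftrightarrow>
     (\<forall>K. compact K \<and> K \<subseteq> \<Omega> \<longrightarrow> integrable (lebesgue_on K) f)"

definition is_weak_grad ::
    "'a::euclidean_space set \<Rightarrow> ('a \<Rightarrow> real) \<Rightarrow> ('a \<Rightarrow> 'a) \<Rightarrow> bool" where
  "is_weak_grad \<Omega> u g \<longleftrightarrow> locally_integrable \<Omega> u \<and> locally_integrable \<Omega> g \<and>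
     (\<forall>\<phi>\<in>test_functions \<Omega>. \<forall>b\<in>Basis.
        (LINT x|lebesgue_on \<Omega>. u x * frechet_derivative \<phi> (at x) b) =
        - (LINT x|lebesgue_on \<Omega>. (g x \<bullet> b) * \<phi> x))"

text \<open>The weak gradient is unique only almost everywhere; one version is chosen. It enters
  below only through integrals over \<open>\<Omega>\<close>.\<close>

definition weak_grad :: "'a::euclidean_space set \<Rightarrow> ('a \<Rightarrow> real) \<Rightarrow> 'a \<Rightarrow> 'a" where
  "weak_grad \<Omega> u = (SOME g. is_weak_grad \<Omega> u g)"

definition in_Lp ::
    "'a::euclidean_space set \<Rightarrow> real \<Rightarrow> ('a \<Rightarrow> 'b::euclidean_space) \<Rightarrow> bool" where
  "in_Lp \<Omega> s f \<longleftrightarrow> f \<in> borel_measurable (lebesgue_on \<Omega>) \<and>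
     integrable (lebesgue_on \<Omega>) (\<lambda>x. norm (f x) powr s)"

definition Lp_norm ::
    "'a::euclidean_space set \<Rightarrow> real \<Rightarrow> ('a \<Rightarrow> 'b::euclidean_space) \<Rightarrow> real" where
  "Lp_norm \<Omega> s f = (LINT x|lebesgue_on \<Omega>. norm (f x) powr s) powr (1 / s)"

definition Linf_norm :: "'a::euclidean_space set \<Rightarrow> ('a \<Rightarrow> real) \<Rightarrow> real" where
  "Linf_norm \<Omega> u = real_of_ereal (esssup (lebesgue_on \<Omega>) (\<lambda>x. ereal \<bar>u x\<bar>))"

definition W1 :: "'a::euclidean_space set \<Rightarrow> real \<Rightarrow> ('a \<Rightarrow> real) set" where
  "W1 \<Omega> m = {u. in_Lp \<Omega> m u \<and> (\<exists>g. is_weak_grad \<Omega> u g \<and> in_Lp \<Omega> m g)}"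

definition W1_norm :: "'a::euclidean_space set \<Rightarrow> real \<Rightarrow> ('a \<Rightarrow> real) \<Rightarrow> real" where
  "W1_norm \<Omega> m u = Lp_norm \<Omega> m u + Lp_norm \<Omega> m (weak_grad \<Omega> u)"

text \<open>\<open>W01 \<Omega> m\<close> is the closure of the test functions in \<open>W1 \<Omega> m\<close>. Its elements are functions,
  not classes modulo null sets, so it contains every representative of each class; what they
  do outside \<open>\<Omega>\<close> is irrelevant.\<close>

definition W01 :: "'a::euclidean_space set \<Rightarrow> real \<Rightarrow> ('a \<Rightarrow> real) set" where
  "W01 \<Omega> m = {u\<in>W1 \<Omega> m. \<forall>\<epsilon>>0. \<exists>\<phi>\<in>test_functions \<Omega>. W1_norm \<Omega> m (\<lambda>x. u x - \<phi> x) < \<epsilon>}"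

definition null_function :: "'a::euclidean_space set \<Rightarrow> ('a \<Rightarrow> real) \<Rightarrow> bool" where
  "null_function \<Omega> u \<longleftrightarrow> (AE x in lebesgue_on \<Omega>. u x = 0)"

definition lambda_inf :: "'a::euclidean_space set \<Rightarrow> real \<Rightarrow> real" where
  "lambda_inf \<Omega> m = (LEAST r. r \<in>
     {Lp_norm \<Omega> m (weak_grad \<Omega> v) powr m / Linf_norm \<Omega> v powr m |v.
        v \<in> W01 \<Omega> m \<and> \<not> null_function \<Omega> v})"

text \<open>For exponents above the dimension each class in \<open>W01\<close> has exactly one representative
  that is continuous on the closure of \<open>\<Omega>\<close> (up to values outside that closure). It is the one
  meant in point evaluations, and \<open>X_space\<close> consists of these representatives.\<close>

definition X_space :: "'a::euclidean_space set \<Rightarrow> real \<Rightarrow> real \<Rightarrow> ('a \<Rightarrow> real) set" where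
  "X_space \<Omega> p q = {u\<in>W01 \<Omega> (max p q). continuous_on (closure \<Omega>) u}"

definition energy ::
    "'a::euclidean_space set \<Rightarrow> real \<Rightarrow> real \<Rightarrow> real \<Rightarrow> ('a \<Rightarrow> real) \<Rightarrow> real" where
  "energy \<Omega> p q lam u =
     1 / p * Lp_norm \<Omega> p (weak_grad \<Omega> u) powr p +
     1 / q * Lp_norm \<Omega> q (weak_grad \<Omega> u) powr q -
     lam / p * Linf_norm \<Omega> u powr p"

definition nehari ::
    "'a::euclidean_space set \<Rightarrow> real \<Rightarrow> real \<Rightarrow> real \<Rightarrow> ('a \<Rightarrow> real) set" where
  "nehari \<Omega> p q lam = {u\<in>X_space \<Omega> p q. \<not> null_function \<Omega> u \<and>
     Lp_norm \<Omega> p (weak_grad \<Omega> u) powr p + Lp_norm \<Omega> q (weak_grad \<Omega> u) powr q =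
     lam * Linf_norm \<Omega> u powr p}"

definition least_energy_solution ::
    "'a::euclidean_space set \<Rightarrow> real \<Rightarrow> real \<Rightarrow> real \<Rightarrow> ('a \<Rightarrow> real) \<Rightarrow> bool" where
  "least_energy_solution \<Omega> p q lam u \<longleftrightarrow>
     (p < q \<and> u \<in> X_space \<Omega> p q \<and>
        (\<forall>v\<in>X_space \<Omega> p q. energy \<Omega> p q lam u \<le> energy \<Omega> p q lam v)) \<or>
     (q < p \<and> u \<in> nehari \<Omega> p q lam \<and>
        (\<forall>v\<in>nehari \<Omega> p q lam. energy \<Omega> p q lam u \<le> energy \<Omega> p q lam v))"

definition weak_solution ::
    "'a::euclidean_space set \<Rightarrow> real \<Rightarrow> real \<Rightarrow> real \<Rightarrow> ('a \<Rightarrow> real) \<Rightarrow> bool" where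
  "weak_solution \<Omega> p q lam u \<longleftrightarrow> u \<in> X_space \<Omega> p q \<and>
     (\<exists>x\<^sub>u\<in>\<Omega>. \<bar>u x\<^sub>u\<bar> = Linf_norm \<Omega> u \<and>
       (\<forall>v\<in>X_space \<Omega> p q.
          (LINT x|lebesgue_on \<Omega>.
             (norm (weak_grad \<Omega> u x) powr (p - 2) + norm (weak_grad \<Omega> u x) powr (q - 2)) *
             (weak_grad \<Omega> u x \<bullet> weak_grad \<Omega> v x)) =
          lam * \<bar>u x\<^sub>u\<bar> powr (p - 2) * u x\<^sub>u * v x\<^sub>u))"

end

theory Submission
  imports Defs "HOL-Real_Asymp.Real_Asymp"
begin

text \<open>
  Morrey's inequality shows that functions in \<open>X_space\<close> vanish on the boundary, so \<open>\<bar>u\<bar>\<close> attains its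
  supremum at an interior point \<open>x\<close>. For every direction \<open>v\<close> the sup norm of \<open>u + t v\<close> is at least
  \<open>\<bar>u x + t * v x\<bar>\<close>, with equality at \<open>t = 0\<close>. Replacing the one by the other in the energy (if
  \<open>p < q\<close>), or in the scaling-invariant form of minimality on the Nehari set (if \<open>q < p\<close>), gives a
  function of \<open>t\<close> that is differentiable and minimal at \<open>0\<close>. That its derivative vanishes is the weak
  equation; every interior maximum point of \<open>\<bar>u\<bar>\<close> will do.
\<close>

section \<open>Smooth bump functions\<close>

text \<open>The weak gradient is a \<open>SOME\<close> choice, so even its linearity is a statement
  about almost every point and rests on uniqueness of weak gradients. Uniqueness needs enough test
  functions, hence the smooth bumps on boxes. The gradient integrals are kept without the root
  (\<open>Lp_mass\<close>): these are what gets differentiated, and a crude quasi-triangle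
  inequality is then enough for every approximation argument.

  Maximum points of u + t v may move with t. Fixing the one of u avoids following them, and as it is
  chosen before v it serves all v at once. The sign of t is free, so the one-sided comparison yields
  an equation.

  In the Nehari case u + t v leaves the constraint set. Let b be the q-integral of the gradient of
  w, and S the number \<open>lam\<close> times the p-th power of the sup norm of w, minus the
  p-integral of the gradient. The factor moving w onto the set is (b/S)^(1/(p-q)), and the energy
  there is a positive multiple of (b^p/S^q)^(1/(p-q)). So u minimizes b^p/S^q where b and S are
  positive, and for u itself S = b.\<close>

lemma frechet_derivative_eq:
  "(f has_derivative f') (at x) \<Longrightarrow> frechet_derivative f (at x) = f'"
  using frechet_derivative_at by metis

text \<open>Needed for the product rule, where f reappears next to its derivative. At the bottom
  level, differentiability supplies the continuity.\<close>

lemma Ck_on_SucD: "Ck_on (Suc k) S f \<Longrightarrow> Ck_on k S f"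
proof (induction k arbitrary: f)
  case 0
  then show ?case
    by (auto intro!: continuous_at_imp_continuous_on differentiable_imp_continuous_within)
next
  case (Suc k)
  have "Ck_on (Suc k) S (\<lambda>x. frechet_derivative f (at x) b)" if "b \<in> Basis" for b
    using Suc.prems that by (subst (asm) Ck_on.simps(2)) blast
  then have "\<forall>b\<in>Basis. Ck_on k S (\<lambda>x. frechet_derivative f (at x) b)"
    using Suc.IH by blast
  then show ?case
    using Suc.prems by simp
qed

lemma Ck_on_const: "Ck_on k S (\<lambda>_. c)"
proof (induction k arbitrary: c)
  case (Suc k)
  have "frechet_derivative (\<lambda>_. c) (at x) = (\<lambda>_. 0)" for x :: 'a
    by (intro frechet_derivative_eq derivative_intros)
  then show ?case
    using Suc by simp
qed simp

lemma Ck_on_UNIV_add: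
  "Ck_on k UNIV f \<Longrightarrow> Ck_on k UNIV g \<Longrightarrow> Ck_on k UNIV (\<lambda>x. f x + g x)"
proof (induction k arbitrary: f g)
  case 0
  then show ?case by (auto intro!: continuous_intros)
next
  case (Suc k)
  have "frechet_derivative (\<lambda>x. f x + g x) (at x) =
      (\<lambda>b. frechet_derivative f (at x) b + frechet_derivative g (at x) b)" for x
    using Suc.prems
    by (intro frechet_derivative_eq has_derivative_add) (auto simp: frechet_derivative_works[symmetric])
  then show ?case
    using Suc by (auto intro: differentiable_add)
qed

lemma Ck_on_UNIV_mult:
  "Ck_on k UNIV f \<Longrightarrow> Ck_on k UNIV g \<Longrightarrow> Ck_on k UNIV (\<lambda>x. f x * g x)"
proof (induction k arbitrary: f g)
  case 0
  then show ?case by (auto intro!: continuous_intros)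
next
  case (Suc k)
  have *: "frechet_derivative (\<lambda>x. f x * g x) (at x) =
      (\<lambda>b. f x * frechet_derivative g (at x) b + frechet_derivative f (at x) b * g x)" for x
    using Suc.prems
    by (intro frechet_derivative_eq has_derivative_mult) (auto simp: frechet_derivative_works[symmetric])
  have "Ck_on k UNIV f" "Ck_on k UNIV g"
    using Suc.prems Ck_on_SucD by blast+
  with * show ?case
    using Suc by (auto intro!: differentiable_mult Ck_on_UNIV_add)
qed

lemma smooth_on_const: "smooth_on S (\<lambda>_. c)"
  by (simp add: smooth_on_def Ck_on_const)

lemma smooth_on_UNIV_add:
  "smooth_on UNIV f \<Longrightarrow> smooth_on UNIV g \<Longrightarrow> smooth_on UNIV (\<lambda>x. f x + g x)"
  by (simp add: smooth_on_def Ck_on_UNIV_add)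

lemma smooth_on_UNIV_mult:
  "smooth_on UNIV f \<Longrightarrow> smooth_on UNIV g \<Longrightarrow> smooth_on UNIV (\<lambda>x. f x * g x)"
  by (simp add: smooth_on_def Ck_on_UNIV_mult)

lemma smooth_on_UNIV_prod:
  assumes "\<And>i. i \<in> I \<Longrightarrow> smooth_on UNIV (f i)"
  shows "smooth_on UNIV (\<lambda>x. \<Prod>i\<in>I. f i x)"
  using assms
  by (induction I rule: infinite_finite_induct) (auto intro: smooth_on_const smooth_on_UNIV_mult)

lemma smooth_on_differentiable: "smooth_on S f \<Longrightarrow> x \<in> S \<Longrightarrow> f differentiable (at x)"
  unfolding smooth_on_def by (metis Ck_on.simps(2))

lemma smooth_on_continuous: "smooth_on S f \<Longrightarrow> continuous_on S f"
  unfolding smooth_on_def by (metis Ck_on.simps(1))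

lemma smooth_on_partial:
  "smooth_on S f \<Longrightarrow> b \<in> Basis \<Longrightarrow> smooth_on S (\<lambda>x. frechet_derivative f (at x) b)"
  unfolding smooth_on_def by (metis Ck_on.simps(2))

text \<open>The polynomial is a parameter because the family P(1/x) exp(-1/x), extended by 0, is
  closed under differentiation; smoothness then becomes a plain induction.\<close>

definition flat_exp :: "real poly \<Rightarrow> real \<Rightarrow> real" where
  "flat_exp P x = (if x > 0 then poly P (1 / x) * exp (- (1 / x)) else 0)"

lemma poly_times_exp_minus_tendsto_0:
  "((\<lambda>x::real. poly P x * exp (- x)) \<longlongrightarrow> 0) at_top"
proof -
  have "((\<lambda>x::real. \<Sum>i\<le>degree P. coeff P i * (x ^ i / exp x)) \<longlongrightarrow> (\<Sum>i\<le>degree P. coeff P i * 0)) at_top"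
    by (intro tendsto_sum tendsto_mult tendsto_const tendsto_power_div_exp_0)
  then show ?thesis
    by (simp add: poly_altdef sum_distrib_right exp_minus divide_inverse mult.assoc)
qed

text \<open>With s = 1/x, the derivative of P(s) exp(-s) in x is s^2 (P(s) - P'(s)) exp(-s), and
  \<open>[:0, 0, 1:]\<close> is the polynomial s^2. At 0 the difference quotient from the right is s
  P(s) exp(-s), which tends to 0 as s grows; this is the polynomial \<open>[:0, 1:] * P\<close>
  below.\<close>

lemma has_real_derivative_flat_exp:
  "(flat_exp P has_real_derivative flat_exp ([:0, 0, 1:] * (P - pderiv P)) x) (at x)"
proof -
  consider "x > 0" | "x < 0" | "x = 0" by linarith
  then show ?thesis
  proof cases
    case 1
    have inv: "((\<lambda>x. 1 / x) has_real_derivative - (1 / x\<^sup>2)) (at x)"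
      using 1 by (auto intro!: derivative_eq_intros simp: power2_eq_square)
    have pol: "((\<lambda>x. poly P (1 / x)) has_real_derivative poly (pderiv P) (1 / x) * - (1 / x\<^sup>2)) (at x)"
      by (rule DERIV_chain2[OF poly_DERIV inv])
    have ex: "((\<lambda>x. exp (- (1 / x))) has_real_derivative exp (- (1 / x)) * - (- (1 / x\<^sup>2))) (at x)"
      by (rule DERIV_chain2[OF DERIV_exp DERIV_minus[OF inv]])
    have "poly (pderiv P) (1 / x) * - (1 / x\<^sup>2) * exp (- (1 / x)) + exp (- (1 / x)) * - (- (1 / x\<^sup>2)) * poly P (1 / x) =
        flat_exp ([:0, 0, 1:] * (P - pderiv P)) x"
      using 1 by (simp add: flat_exp_def power2_eq_square algebra_simps)
    with DERIV_mult[OF pol ex]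
    have "((\<lambda>x. poly P (1 / x) * exp (- (1 / x))) has_real_derivative
        flat_exp ([:0, 0, 1:] * (P - pderiv P)) x) (at x)"
      by simp
    then show ?thesis
      by (rule has_field_derivative_transform_within[where d = x])
        (use 1 in \<open>auto simp: flat_exp_def dist_real_def\<close>)
  next
    case 2
    have "((\<lambda>x. 0) has_real_derivative flat_exp ([:0, 0, 1:] * (P - pderiv P)) x) (at x)"
      using 2 by (simp add: flat_exp_def)
    then show ?thesis
      by (rule has_field_derivative_transform_within[where d = "-x"])
        (use 2 in \<open>auto simp: flat_exp_def dist_real_def\<close>)
  next
    case 3
    have "((\<lambda>y. flat_exp P y / y) \<longlongrightarrow> 0) (at_right 0)"
    proof -
      have "((\<lambda>y::real. poly ([:0, 1:] * P) (inverse y) * exp (- inverse y)) \<longlongrightarrow> 0) (at_right 0)"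
        by (rule filterlim_compose[OF poly_times_exp_minus_tendsto_0 filterlim_inverse_at_top_right])
      moreover have "\<forall>\<^sub>F y in at_right 0.
          poly ([:0, 1:] * P) (inverse y) * exp (- inverse y) = flat_exp P y / y"
        using eventually_at_right_less[of "0::real"]
        by (rule eventually_mono) (simp add: flat_exp_def divide_inverse mult_ac)
      ultimately show ?thesis
        by (rule Lim_transform_eventually)
    qed
    moreover have "((\<lambda>y. flat_exp P y / y) \<longlongrightarrow> 0) (at_left 0)"
      by (rule tendsto_eventually, rule eventually_at_leftI[of "-1"]) (simp_all add: flat_exp_def)
    ultimately have "((\<lambda>y. flat_exp P y / y) \<longlongrightarrow> 0) (at 0)"
      by (simp add: filterlim_split_at)
    then show ?thesis
      using 3 by (simp add: has_field_derivative_iff flat_exp_def)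
  qed
qed

lemma smooth_on_flat_exp_affine: "smooth_on UNIV (\<lambda>x::'a::euclidean_space. flat_exp P (w \<bullet> x + c))"
proof -
  have D: "((\<lambda>x. flat_exp P (w \<bullet> x + c)) has_derivative
      (\<lambda>h. flat_exp ([:0, 0, 1:] * (P - pderiv P)) (w \<bullet> x + c) * (w \<bullet> h))) (at x)" for P and x :: 'a
    by (rule has_derivative_compose[of "\<lambda>x. w \<bullet> x + c" "\<lambda>h. w \<bullet> h" x UNIV "flat_exp P",
          OF _ has_real_derivative_flat_exp[unfolded has_field_derivative_def]])
      (auto intro!: derivative_eq_intros)
  have "Ck_on k UNIV (\<lambda>x::'a. flat_exp P (w \<bullet> x + c))" for k
  proof (induction k arbitrary: P)
    case 0
    have "(\<lambda>x. flat_exp P (w \<bullet> x + c)) differentiable at x" for x :: 'a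
      using D differentiable_def by blast
    then show ?case
      by (auto intro!: continuous_at_imp_continuous_on differentiable_imp_continuous_within)
  next
    case (Suc k)
    have "(\<lambda>x. flat_exp P (w \<bullet> x + c)) differentiable at x" for x :: 'a
      using D differentiable_def by blast
    then show ?case
      using Suc by (auto simp only: frechet_derivative_eq[OF D] Ck_on.simps intro!: Ck_on_UNIV_mult Ck_on_const)
  qed
  then show ?thesis by (simp add: smooth_on_def)
qed

text \<open>The factors are exp(-1/(r d)) for the distances d of x to the faces of the box. Raising
  r moves them towards 1 inside without enlarging the support. The arguments are spelled as
  \<open>w \<bullet> x + c\<close> to match \<open>smooth_on_flat_exp_affine\<close>.\<close>

definition box_bump :: "'a::euclidean_space \<Rightarrow> 'a \<Rightarrow> real \<Rightarrow> 'a \<Rightarrow> real" where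
  "box_bump a b r x =
     (\<Prod>i\<in>Basis. flat_exp 1 ((r *\<^sub>R i) \<bullet> x + - r * (a \<bullet> i)) * flat_exp 1 ((- r *\<^sub>R i) \<bullet> x + r * (b \<bullet> i)))"

lemma flat_exp_1_bounds: "0 \<le> flat_exp 1 x" "flat_exp 1 x \<le> 1"
  by (auto simp: flat_exp_def)

lemma box_bump_bounds: "0 \<le> box_bump a b r x" "box_bump a b r x \<le> 1"
  unfolding box_bump_def by (intro prod_nonneg prod_le_1 mult_le_one mult_nonneg_nonneg flat_exp_1_bounds conjI)+

lemma box_bump_eq_0:
  assumes "r > 0" "x \<notin> box a b"
  shows "box_bump a b r x = 0"
proof -
  obtain i where i: "i \<in> Basis" "\<not> (a \<bullet> i < x \<bullet> i \<and> x \<bullet> i < b \<bullet> i)"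
    using assms by (auto simp: box_def)
  then have "(r *\<^sub>R i) \<bullet> x + - r * (a \<bullet> i) \<le> 0 \<or> (- r *\<^sub>R i) \<bullet> x + r * (b \<bullet> i) \<le> 0"
    using assms(1) by (auto simp: inner_commute not_less)
  then have "flat_exp 1 ((r *\<^sub>R i) \<bullet> x + - r * (a \<bullet> i)) * flat_exp 1 ((- r *\<^sub>R i) \<bullet> x + r * (b \<bullet> i)) = 0"
    by (auto simp: flat_exp_def)
  then show ?thesis
    unfolding box_bump_def using i(1) by (intro prod_zero) auto
qed

lemma box_bump_tendsto_indicator:
  "(\<lambda>n. box_bump a b (real (Suc n)) x) \<longlonglongrightarrow> indicator (box a b) x"
proof (cases "x \<in> box a b")
  case True
  have lim: "(\<lambda>n. flat_exp 1 (real (Suc n) * d)) \<longlonglongrightarrow> 1" if "d > 0" for d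
    unfolding flat_exp_def using that by (simp del: of_nat_Suc) real_asymp
  have "(\<lambda>n. \<Prod>i\<in>Basis. flat_exp 1 (real (Suc n) * (x \<bullet> i - a \<bullet> i)) * flat_exp 1 (real (Suc n) * (b \<bullet> i - x \<bullet> i)))
      \<longlonglongrightarrow> (\<Prod>i\<in>(Basis :: 'a set). 1 * 1)"
    using True by (intro tendsto_prod tendsto_mult lim) (auto simp: box_def)
  then show ?thesis
    using True by (simp add: box_bump_def inner_commute algebra_simps)
next
  case False
  then show ?thesis by (simp add: box_bump_eq_0)
qed

lemma box_bump_test_function:
  assumes "r > 0" "cbox a b \<subseteq> \<Omega>"
  shows "box_bump a b r \<in> test_functions \<Omega>"
proof -
  have "smooth_on UNIV (box_bump a b r)"
    unfolding box_bump_def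
    by (intro smooth_on_UNIV_prod smooth_on_UNIV_mult smooth_on_flat_exp_affine)
  moreover have "closure {x. box_bump a b r x \<noteq> 0} \<subseteq> cbox a b"
    using box_bump_eq_0[OF assms(1), of _ a b] box_subset_cbox[of a b]
    by (intro closure_minimal) blast+
  ultimately show ?thesis
    using assms(2) unfolding test_functions_def
    by (auto simp: compact_eq_bounded_closed bounded_subset[OF bounded_cbox])
qed

section \<open>Test functions and weak gradients\<close>

lemma integrable_lebesgue_on_iff:
  fixes f :: "'a::euclidean_space \<Rightarrow> 'b::{banach, second_countable_topology}"
  assumes "S \<in> sets lebesgue"
  shows "integrable (lebesgue_on S) f \<longleftrightarrow> integrable lebesgue (\<lambda>x. indicator S x *\<^sub>R f x)"
  using assms by (intro integrable_restrict_space) simp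

lemma integral_lebesgue_on_eq:
  fixes f :: "'a::euclidean_space \<Rightarrow> 'b::{banach, second_countable_topology}"
  assumes "S \<in> sets lebesgue"
  shows "(LINT x|lebesgue_on S. f x) = (LINT x|lebesgue. indicator S x *\<^sub>R f x)"
  using assms by (intro integral_restrict_space) simp

lemma open_sets_lebesgue: "open S \<Longrightarrow> S \<in> sets lebesgue"
  by simp

lemma compact_sets_lebesgue: "compact S \<Longrightarrow> S \<in> sets lebesgue"
  by (simp add: borel_compact)

lemma test_functionsD:
  assumes "\<phi> \<in> test_functions \<Omega>"
  shows "smooth_on UNIV \<phi>" "compact (closure {x. \<phi> x \<noteq> 0})" "closure {x. \<phi> x \<noteq> 0} \<subseteq> \<Omega>"
    "continuous_on S \<phi>" "\<phi> differentiable (at x)"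
  using assms smooth_on_continuous[of UNIV \<phi>] smooth_on_differentiable[of UNIV \<phi> x]
    continuous_on_subset[of UNIV \<phi> S]
  by (simp_all add: test_functions_def)

lemma test_function_eq_0: "\<phi> \<in> test_functions \<Omega> \<Longrightarrow> x \<notin> \<Omega> \<Longrightarrow> \<phi> x = 0"
  using test_functionsD(3)[of \<phi> \<Omega>] closure_subset[of "{x. \<phi> x \<noteq> 0}"] by blast

lemma test_functionsI:
  assumes "smooth_on UNIV \<phi>" "\<psi> \<in> test_functions \<Omega>" "{x. \<phi> x \<noteq> 0} \<subseteq> closure {x. \<psi> x \<noteq> 0}"
  shows "\<phi> \<in> test_functions \<Omega>"
proof -
  have "closure {x. \<phi> x \<noteq> 0} \<subseteq> closure {x. \<psi> x \<noteq> 0}"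
    using assms(3) by (simp add: closure_minimal)
  then show ?thesis
    using assms test_functionsD[OF assms(2)] unfolding test_functions_def
    by (metis (no_types, lifting) bounded_subset closed_closure compact_eq_bounded_closed mem_Collect_eq subset_trans)
qed

lemma test_function_0: "(\<lambda>_. 0) \<in> test_functions \<Omega>"
  by (simp add: test_functions_def smooth_on_const)

lemma test_function_mult:
  "\<phi> \<in> test_functions \<Omega> \<Longrightarrow> smooth_on UNIV f \<Longrightarrow> (\<lambda>x. f x * \<phi> x) \<in> test_functions \<Omega>"
  by (rule test_functionsI[of _ \<phi>])
     (use closure_subset[of "{x. \<phi> x \<noteq> 0}"] in \<open>auto intro: smooth_on_UNIV_mult test_functionsD\<close>)

lemma test_function_scale: "\<phi> \<in> test_functions \<Omega> \<Longrightarrow> (\<lambda>x. c * \<phi> x) \<in> test_functions \<Omega>"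
  by (intro test_function_mult smooth_on_const)

lemma test_function_add:
  assumes "\<phi> \<in> test_functions \<Omega>" "\<psi> \<in> test_functions \<Omega>"
  shows "(\<lambda>x. \<phi> x + \<psi> x) \<in> test_functions \<Omega>"
proof -
  have sub: "closure {x. \<phi> x + \<psi> x \<noteq> 0} \<subseteq> closure {x. \<phi> x \<noteq> 0} \<union> closure {x. \<psi> x \<noteq> 0}"
    using closure_subset[of "{x. \<phi> x \<noteq> 0}"] closure_subset[of "{x. \<psi> x \<noteq> 0}"]
    by (intro closure_minimal closed_Un closed_closure) fastforce
  have "compact (closure {x. \<phi> x \<noteq> 0} \<union> closure {x. \<psi> x \<noteq> 0})"
    using assms test_functionsD(2) by blast
  then have "compact (closure {x. \<phi> x + \<psi> x \<noteq> 0})"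
    using sub by (meson bounded_subset closed_closure compact_eq_bounded_closed)
  moreover have "closure {x. \<phi> x + \<psi> x \<noteq> 0} \<subseteq> \<Omega>"
    using sub test_functionsD(3)[OF assms(1)] test_functionsD(3)[OF assms(2)] by blast
  ultimately show ?thesis
    using assms test_functionsD(1) by (auto simp: test_functions_def intro!: smooth_on_UNIV_add)
qed

lemma test_function_partial:
  assumes "\<phi> \<in> test_functions \<Omega>" "b \<in> Basis"
  shows "(\<lambda>x. frechet_derivative \<phi> (at x) b) \<in> test_functions \<Omega>"
proof (rule test_functionsI[OF _ assms(1)])
  show "{x. frechet_derivative \<phi> (at x) b \<noteq> 0} \<subseteq> closure {x. \<phi> x \<noteq> 0}"
  proof (rule ccontr)
    assume "\<not> ?thesis"
    then obtain x where x: "frechet_derivative \<phi> (at x) b \<noteq> 0" "x \<in> - closure {x. \<phi> x \<noteq> 0}"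
      by blast
    have "(\<phi> has_derivative (\<lambda>_. 0)) (at x)"
      by (rule has_derivative_transform_within_open[of "\<lambda>_. 0" _ _ _ "- closure {x. \<phi> x \<noteq> 0}"])
        (use x(2) closure_subset[of "{x. \<phi> x \<noteq> 0}"] in \<open>auto intro: derivative_intros\<close>)
    then show False
      using x(1) frechet_derivative_eq[of \<phi> "\<lambda>_. 0" x] by simp
  qed
qed (rule smooth_on_partial[OF test_functionsD(1)[OF assms(1)] assms(2)])

lemma continuous_imp_locally_integrable:
  fixes f :: "'a::euclidean_space \<Rightarrow> 'b::euclidean_space"
  assumes "continuous_on \<Omega> f"
  shows "locally_integrable \<Omega> f"
  unfolding locally_integrable_def
proof (intro allI impI)
  fix K assume K: "compact K \<and> K \<subseteq> \<Omega>"
  then have "integrable lborel (\<lambda>x. indicator K x *\<^sub>R f x)"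
    using assms by (intro borel_integrable_compact) (auto intro: continuous_on_subset)
  then have "integrable lebesgue (\<lambda>x. indicator K x *\<^sub>R f x)"
    by (subst integrable_completion) auto
  then show "integrable (lebesgue_on K) f"
    using K by (subst integrable_lebesgue_on_iff) (auto simp: compact_sets_lebesgue)
qed

lemma locally_integrable_lincomb:
  fixes f g :: "'a::euclidean_space \<Rightarrow> 'b::euclidean_space"
  assumes "locally_integrable \<Omega> f" "locally_integrable \<Omega> g"
  shows "locally_integrable \<Omega> (\<lambda>x. \<alpha> *\<^sub>R f x + \<beta> *\<^sub>R g x)"
  using assms by (auto simp: locally_integrable_def)

text \<open>The product lives on the compact support of the test function, where local integrability
  applies and the test function is bounded; extended by zero it is the same integrand on
  \<open>K\<close> and on \<open>\<Omega>\<close>.\<close>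

lemma integrable_test_mult:
  fixes f :: "'a::euclidean_space \<Rightarrow> 'b::euclidean_space"
  assumes "open \<Omega>" "locally_integrable \<Omega> f" "\<phi> \<in> test_functions \<Omega>"
  shows "integrable (lebesgue_on \<Omega>) (\<lambda>x. \<phi> x *\<^sub>R f x)"
proof -
  define K where "K = closure {x. \<phi> x \<noteq> 0}"
  have K: "compact K" "K \<subseteq> \<Omega>" and K0: "\<And>x. x \<notin> K \<Longrightarrow> \<phi> x = 0"
    using test_functionsD[OF assms(3)] closure_subset[of "{x. \<phi> x \<noteq> 0}"] by (auto simp: K_def)
  have fK: "integrable (lebesgue_on K) f"
    using assms(2) K by (simp add: locally_integrable_def)
  have "bounded (\<phi> ` K)"
    using K(1) test_functionsD(4)[OF assms(3)] by (simp add: compact_continuous_image compact_imp_bounded)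
  then obtain B where B: "\<And>x. x \<in> K \<Longrightarrow> \<bar>\<phi> x\<bar> \<le> B"
    by (auto simp: bounded_iff)
  have "\<phi> \<in> borel_measurable (lebesgue_on K)"
    using test_functionsD(4)[OF assms(3)] K(1)
    by (intro continuous_imp_measurable_on_sets_lebesgue compact_sets_lebesgue)
  then have "(\<lambda>x. \<phi> x *\<^sub>R f x) \<in> borel_measurable (lebesgue_on K)"
    using fK by measurable
  then have "integrable (lebesgue_on K) (\<lambda>x. \<phi> x *\<^sub>R f x)"
  proof (rule Bochner_Integration.integrable_bound[OF integrable_norm[OF integrable_scaleR_right[OF fK, of B]]])
    show "AE x in lebesgue_on K. norm (\<phi> x *\<^sub>R f x) \<le> norm (norm (B *\<^sub>R f x))"
    proof (rule AE_I2)
      fix x assume "x \<in> space (lebesgue_on K)"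
      then have "\<bar>\<phi> x\<bar> \<le> \<bar>B\<bar>" using B[of x] by simp
      then show "norm (\<phi> x *\<^sub>R f x) \<le> norm (norm (B *\<^sub>R f x))"
        by (simp add: mult_right_mono)
    qed
  qed
  moreover have "(\<lambda>x. indicator K x *\<^sub>R \<phi> x *\<^sub>R f x) = (\<lambda>x. indicator \<Omega> x *\<^sub>R \<phi> x *\<^sub>R f x)"
    using K(2) K0 by (auto simp: fun_eq_iff indicator_def)
  ultimately show ?thesis
    using assms(1) K(1) by (simp add: integrable_lebesgue_on_iff compact_sets_lebesgue)
qed

lemma
  assumes "\<phi> \<in> test_functions \<Omega>"
  shows integrable_lborel_test_function: "integrable lborel \<phi>"
    and integral_test_function_eq_lborel:
      "open \<Omega> \<Longrightarrow> (LINT x|lebesgue_on \<Omega>. \<phi> x) = (LINT x|lborel. \<phi> x)"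
proof -
  define K where "K = closure {x. \<phi> x \<noteq> 0}"
  have "integrable lborel (\<lambda>x. indicator K x *\<^sub>R \<phi> x)"
    using test_functionsD[OF assms] by (intro borel_integrable_compact) (auto simp: K_def)
  moreover have "(\<lambda>x. indicator K x *\<^sub>R \<phi> x) = \<phi>"
    using closure_subset[of "{x. \<phi> x \<noteq> 0}"] by (auto simp: K_def fun_eq_iff indicator_def)
  ultimately show i: "integrable lborel \<phi>" by (simp only:)
  have "(\<lambda>x. indicator \<Omega> x *\<^sub>R \<phi> x) = \<phi>"
    using test_function_eq_0[OF assms] by (auto simp: fun_eq_iff indicator_def)
  then have "(LINT x|lebesgue_on \<Omega>. \<phi> x) = (LINT x|lebesgue. \<phi> x)" if "open \<Omega>"
    using integral_lebesgue_on_eq[OF open_sets_lebesgue[OF that], of \<phi>] by (simp only:)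
  then show "(LINT x|lebesgue_on \<Omega>. \<phi> x) = (LINT x|lborel. \<phi> x)" if "open \<Omega>"
    using that integral_completion[OF borel_measurable_integrable[OF i]] by (simp only:)
qed

lemma has_derivative_test_function_line:
  assumes "\<phi> \<in> test_functions \<Omega>"
  shows "((\<lambda>t. \<phi> (x + t *\<^sub>R h)) has_real_derivative frechet_derivative \<phi> (at (x + t *\<^sub>R h)) h) (at t within T)"
proof -
  have D: "(\<phi> has_derivative frechet_derivative \<phi> (at (x + t *\<^sub>R h))) (at (x + t *\<^sub>R h))"
    using test_functionsD(5)[OF assms] by (simp add: frechet_derivative_works)
  then have lin: "frechet_derivative \<phi> (at (x + t *\<^sub>R h)) (s *\<^sub>R h) = s * frechet_derivative \<phi> (at (x + t *\<^sub>R h)) h" for s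
    using linear_cmul[OF has_derivative_linear[OF D]] by simp
  have "((\<lambda>t. \<phi> (x + t *\<^sub>R h)) has_derivative (\<lambda>s. frechet_derivative \<phi> (at (x + t *\<^sub>R h)) (s *\<^sub>R h))) (at t within T)"
    by (rule has_derivative_compose[of "\<lambda>t. x + t *\<^sub>R h" "\<lambda>s. s *\<^sub>R h", OF _ D])
      (auto intro!: derivative_eq_intros)
  then show ?thesis
    by (simp add: has_field_derivative_def lin mult_commute_abs)
qed

text \<open>Translation invariance: \<open>t \<mapsto> \<integral> \<phi> (x + t b) dx\<close> is constant, and its derivative is the
  integral of the partial derivative.\<close>

lemma integral_partial_test_function:
  fixes \<phi> :: "'a::euclidean_space \<Rightarrow> real"
  assumes "\<phi> \<in> test_functions \<Omega>" "b \<in> Basis"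
  shows "(LINT x|lborel. frechet_derivative \<phi> (at x) b) = 0"
proof -
  note psi = test_function_partial[OF assms]
  have "bounded (closure {x. \<phi> x \<noteq> 0} \<union> closure {x. frechet_derivative \<phi> (at x) b \<noteq> 0})"
    using test_functionsD(2)[OF assms(1)] test_functionsD(2)[OF psi] by (simp add: compact_imp_bounded)
  then obtain R where R0:
    "\<forall>x\<in>closure {x. \<phi> x \<noteq> 0} \<union> closure {x. frechet_derivative \<phi> (at x) b \<noteq> 0}. norm x \<le> R"
    unfolding bounded_iff by blast
  have R: "norm x \<le> R" if "\<phi> x \<noteq> 0 \<or> frechet_derivative \<phi> (at x) b \<noteq> 0" for x
    using R0 that closure_subset[of "{x. \<phi> x \<noteq> 0}"]
      closure_subset[of "{x. frechet_derivative \<phi> (at x) b \<noteq> 0}"] by blast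
  \<comment> \<open>The margin 1 around the supports keeps every translate by \<open>t\<close> with
    absolute value below 1 inside one fixed compact box, over which differentiation under the
    integral is available.\<close>
  obtain c :: 'a where c: "cball 0 (R + 1) \<subseteq> cbox (-c) c"
    using bounded_subset_cbox_symmetric[OF bounded_cball] by metis
  have out: "\<phi> (x + t *\<^sub>R b) = 0" if "x \<notin> cbox (-c) c" "\<bar>t\<bar> < 1" for x t
  proof (rule ccontr)
    assume "\<phi> (x + t *\<^sub>R b) \<noteq> 0"
    then have "norm (x + t *\<^sub>R b) \<le> R" by (intro R) simp
    moreover have "norm x \<le> norm (x + t *\<^sub>R b) + norm (t *\<^sub>R b)"
      by (metis add_diff_cancel_right' norm_triangle_ineq4)
    ultimately have "norm x \<le> R + 1" using assms(2) that by simp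
    then show False using c that by auto
  qed
  have const: "integral (cbox (-c) c) (\<lambda>x. \<phi> (x + t *\<^sub>R b)) = (LINT x|lborel. \<phi> x)" if "\<bar>t\<bar> < 1" for t
  proof -
    have m: "\<phi> \<in> borel_measurable borel"
      using integrable_lborel_test_function[OF assms(1)] by auto
    have tr: "integrable lborel (\<lambda>x. \<phi> (t *\<^sub>R b + x))" "(LINT x|lborel. \<phi> (t *\<^sub>R b + x)) = (LINT x|lborel. \<phi> x)"
      using integral_distr[of "(+) (t *\<^sub>R b)" lborel borel \<phi>]
        integrable_distr[of "(+) (t *\<^sub>R b)" lborel borel \<phi>] m integrable_lborel_test_function[OF assms(1)]
      by (auto simp: lborel_distr_plus)
    have "integral (cbox (-c) c) (\<lambda>x. \<phi> (x + t *\<^sub>R b)) = integral UNIV (\<lambda>x. \<phi> (x + t *\<^sub>R b))"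
      using out[OF _ that]
      by (subst integral_restrict_UNIV[symmetric]) (auto intro!: arg_cong[where f = "integral UNIV"])
    also have "\<dots> = (LINT x|lborel. \<phi> x)"
      using integral_lborel[OF tr(1)] tr(2) by (simp add: add.commute)
    finally show ?thesis .
  qed
  have "((\<lambda>t. integral (cbox (-c) c) (\<lambda>x. \<phi> (x + t *\<^sub>R b))) has_real_derivative
      integral (cbox (-c) c) (\<lambda>x. frechet_derivative \<phi> (at (x + 0 *\<^sub>R b)) b)) (at 0 within {-1<..<1})"
  proof (rule leibniz_rule_field_derivative[where fx = "\<lambda>t x. frechet_derivative \<phi> (at (x + t *\<^sub>R b)) b"])
    show "(\<lambda>x. \<phi> (x + t *\<^sub>R b)) integrable_on cbox (-c) c" for t
      by (intro integrable_continuous continuous_on_compose2[OF test_functionsD(4)[OF assms(1), of UNIV]]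
          continuous_intros) auto
    show "continuous_on ({-1<..<1} \<times> cbox (-c) c) (\<lambda>(t, x). frechet_derivative \<phi> (at (x + t *\<^sub>R b)) b)"
      unfolding split_def
      by (intro continuous_on_compose2[OF test_functionsD(4)[OF psi, of UNIV]] continuous_intros) auto
  qed (use has_derivative_test_function_line[OF assms(1)] in auto)
  then have "((\<lambda>t. integral (cbox (-c) c) (\<lambda>x. \<phi> (x + t *\<^sub>R b))) has_real_derivative
      integral (cbox (-c) c) (\<lambda>x. frechet_derivative \<phi> (at x) b)) (at 0)"
    by (subst (asm) at_within_open) auto
  moreover have "((\<lambda>t. integral (cbox (-c) c) (\<lambda>x. \<phi> (x + t *\<^sub>R b))) has_real_derivative 0) (at 0)"
    by (rule has_field_derivative_transform_within[of "\<lambda>_. LINT x|lborel. \<phi> x" _ _ _ 1])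
      (auto simp: const)
  ultimately have "integral (cbox (-c) c) (\<lambda>x. frechet_derivative \<phi> (at x) b) = 0"
    using DERIV_unique by blast
  moreover have "frechet_derivative \<phi> (at x) b = 0" if "x \<notin> cbox (-c) c" for x
  proof (rule ccontr)
    assume "frechet_derivative \<phi> (at x) b \<noteq> 0"
    then have "norm x \<le> R" by (intro R) simp
    then have "x \<in> cball 0 (R + 1)" by simp
    then show False using c that by blast
  qed
  then have "integral (cbox (-c) c) (\<lambda>x. frechet_derivative \<phi> (at x) b) =
      integral UNIV (\<lambda>x. frechet_derivative \<phi> (at x) b)"
    by (subst integral_restrict_UNIV[symmetric]) (auto intro!: arg_cong[where f = "integral UNIV"])
  ultimately show ?thesis
    using integral_lborel[OF integrable_lborel_test_function[OF psi]] by simp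
qed

section \<open>Classical gradients as weak gradients, and linearity\<close>

definition gradient :: "('a::euclidean_space \<Rightarrow> real) \<Rightarrow> 'a \<Rightarrow> 'a" where
  "gradient \<phi> x = (\<Sum>b\<in>Basis. frechet_derivative \<phi> (at x) b *\<^sub>R b)"

lemma gradient_inner_Basis: "b \<in> Basis \<Longrightarrow> gradient \<phi> x \<bullet> b = frechet_derivative \<phi> (at x) b"
  by (simp add: gradient_def)

lemma gradient_inner:
  assumes "\<phi> differentiable (at x)"
  shows "gradient \<phi> x \<bullet> h = frechet_derivative \<phi> (at x) h"
proof -
  have lin: "linear (frechet_derivative \<phi> (at x))"
    using assms by (simp add: linear_frechet_derivative)
  have "frechet_derivative \<phi> (at x) h = frechet_derivative \<phi> (at x) (\<Sum>b\<in>Basis. (h \<bullet> b) *\<^sub>R b)"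
    by (simp add: euclidean_representation)
  also have "\<dots> = (\<Sum>b\<in>Basis. (h \<bullet> b) * frechet_derivative \<phi> (at x) b)"
    using lin by (simp add: linear_sum linear_cmul)
  also have "\<dots> = gradient \<phi> x \<bullet> h"
    by (simp add: gradient_def inner_sum_left inner_sum_right inner_commute mult.commute)
  finally show ?thesis by simp
qed

lemma continuous_on_gradient:
  assumes "\<phi> \<in> test_functions \<Omega>"
  shows "continuous_on S (gradient \<phi>)"
  unfolding gradient_def
  by (intro continuous_intros test_functionsD(4)[OF test_function_partial[OF assms]])

text \<open>Integration by parts: the product of the two test functions is a test function, so its
  partial derivative integrates to 0.\<close>

lemma is_weak_grad_test_function:
  assumes "open \<Omega>" "\<phi> \<in> test_functions \<Omega>"
  shows "is_weak_grad \<Omega> \<phi> (gradient \<phi>)"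
  unfolding is_weak_grad_def
proof (intro conjI ballI)
  show "locally_integrable \<Omega> \<phi>" "locally_integrable \<Omega> (gradient \<phi>)"
    using test_functionsD(4)[OF assms(2)] continuous_on_gradient[OF assms(2)]
    by (auto intro: continuous_imp_locally_integrable)
next
  fix \<psi> and b :: 'a assume psi: "\<psi> \<in> test_functions \<Omega>" and b: "b \<in> Basis"
  note dphi = test_function_partial[OF assms(2) b] and dpsi = test_function_partial[OF psi b]
  have "frechet_derivative (\<lambda>x. \<phi> x * \<psi> x) (at x) =
      (\<lambda>h. \<phi> x * frechet_derivative \<psi> (at x) h + frechet_derivative \<phi> (at x) h * \<psi> x)" for x
    using test_functionsD(5)[OF assms(2)] test_functionsD(5)[OF psi]
    by (intro frechet_derivative_eq has_derivative_mult) (auto simp: frechet_derivative_works[symmetric])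
  then have "0 = (LINT x|lborel. \<phi> x * frechet_derivative \<psi> (at x) b + frechet_derivative \<phi> (at x) b * \<psi> x)"
    using integral_partial_test_function[OF test_function_mult[OF psi test_functionsD(1)[OF assms(2)]] b]
    by simp
  also have "\<dots> = (LINT x|lborel. \<phi> x * frechet_derivative \<psi> (at x) b) + (LINT x|lborel. frechet_derivative \<phi> (at x) b * \<psi> x)"
    by (intro Bochner_Integration.integral_add integrable_lborel_test_function[of _ \<Omega>]
        test_function_mult test_functionsD(1)[OF dphi] test_functionsD(1)[OF assms(2)] psi dpsi)
  also have "\<dots> = (LINT x|lebesgue_on \<Omega>. \<phi> x * frechet_derivative \<psi> (at x) b) +
      (LINT x|lebesgue_on \<Omega>. frechet_derivative \<phi> (at x) b * \<psi> x)"
    by (intro arg_cong2[where f = "(+)"] integral_test_function_eq_lborel[symmetric] assms(1)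
        test_function_mult test_functionsD(1)[OF dphi] test_functionsD(1)[OF assms(2)] psi dpsi)
  finally show "(LINT x|lebesgue_on \<Omega>. \<phi> x * frechet_derivative \<psi> (at x) b) =
      - (LINT x|lebesgue_on \<Omega>. gradient \<phi> x \<bullet> b * \<psi> x)"
    using b by (simp add: gradient_inner_Basis)
qed

lemma is_weak_grad_lincomb:
  assumes "open \<Omega>" "is_weak_grad \<Omega> u g" "is_weak_grad \<Omega> v h"
  shows "is_weak_grad \<Omega> (\<lambda>x. \<alpha> * u x + \<beta> * v x) (\<lambda>x. \<alpha> *\<^sub>R g x + \<beta> *\<^sub>R h x)"
  unfolding is_weak_grad_def
proof (intro conjI ballI)
  show "locally_integrable \<Omega> (\<lambda>x. \<alpha> * u x + \<beta> * v x)"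
    "locally_integrable \<Omega> (\<lambda>x. \<alpha> *\<^sub>R g x + \<beta> *\<^sub>R h x)"
    using assms locally_integrable_lincomb[of \<Omega> u v \<alpha> \<beta>] locally_integrable_lincomb[of \<Omega> g h \<alpha> \<beta>]
    by (auto simp: is_weak_grad_def)
next
  fix \<phi> and b :: 'a assume phi: "\<phi> \<in> test_functions \<Omega>" and b: "b \<in> Basis"
  note dphi = test_function_partial[OF phi b]
  have i: "integrable (lebesgue_on \<Omega>) (\<lambda>x. w x * frechet_derivative \<phi> (at x) b)"
    if "is_weak_grad \<Omega> w k" for w k
    using integrable_test_mult[OF assms(1) _ dphi, of w] that by (simp add: is_weak_grad_def mult.commute)
  have j: "integrable (lebesgue_on \<Omega>) (\<lambda>x. k x \<bullet> b * \<phi> x)" if "is_weak_grad \<Omega> w k" for w k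
  proof -
    have "integrable (lebesgue_on \<Omega>) (\<lambda>x. (\<phi> x *\<^sub>R k x) \<bullet> b)"
      by (intro integrable_inner_left integrable_test_mult assms(1) phi)
        (use that in \<open>simp add: is_weak_grad_def\<close>)
    then show ?thesis by (simp add: mult.commute)
  qed
  have "(LINT x|lebesgue_on \<Omega>. (\<alpha> * u x + \<beta> * v x) * frechet_derivative \<phi> (at x) b) =
      (LINT x|lebesgue_on \<Omega>. \<alpha> * (u x * frechet_derivative \<phi> (at x) b) + \<beta> * (v x * frechet_derivative \<phi> (at x) b))"
    by (simp add: algebra_simps)
  also have "\<dots> = \<alpha> * (LINT x|lebesgue_on \<Omega>. u x * frechet_derivative \<phi> (at x) b) +
      \<beta> * (LINT x|lebesgue_on \<Omega>. v x * frechet_derivative \<phi> (at x) b)"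
    using i[OF assms(2)] i[OF assms(3)] by (subst Bochner_Integration.integral_add) auto
  also have "\<dots> = - (\<alpha> * (LINT x|lebesgue_on \<Omega>. g x \<bullet> b * \<phi> x) + \<beta> * (LINT x|lebesgue_on \<Omega>. h x \<bullet> b * \<phi> x))"
    using assms phi b by (simp add: is_weak_grad_def)
  also have "\<alpha> * (LINT x|lebesgue_on \<Omega>. g x \<bullet> b * \<phi> x) + \<beta> * (LINT x|lebesgue_on \<Omega>. h x \<bullet> b * \<phi> x) =
      (LINT x|lebesgue_on \<Omega>. \<alpha> * (g x \<bullet> b * \<phi> x) + \<beta> * (h x \<bullet> b * \<phi> x))"
    using j[OF assms(2)] j[OF assms(3)] by (subst Bochner_Integration.integral_add) auto
  finally show "(LINT x|lebesgue_on \<Omega>. (\<alpha> * u x + \<beta> * v x) * frechet_derivative \<phi> (at x) b) =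
      - (LINT x|lebesgue_on \<Omega>. (\<alpha> *\<^sub>R g x + \<beta> *\<^sub>R h x) \<bullet> b * \<phi> x)"
    by (simp add: algebra_simps inner_add_left)
qed

section \<open>The fundamental lemma of the calculus of variations and uniqueness of weak
  gradients\<close>

lemma integral_cbox_eq_0_if_test_orthogonal:
  fixes g :: "'a::euclidean_space \<Rightarrow> real"
  assumes "open \<Omega>" "locally_integrable \<Omega> g"
    and orth: "\<And>\<phi>. \<phi> \<in> test_functions \<Omega> \<Longrightarrow> (LINT x|lebesgue_on \<Omega>. g x * \<phi> x) = 0"
    and sub: "cbox a b \<subseteq> \<Omega>"
  shows "integral (cbox a b) g = 0"
proof -
  have gi: "integrable (lebesgue_on (cbox a b)) g"
    using assms(2) sub by (simp add: locally_integrable_def)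
  then have gc: "integrable lebesgue (\<lambda>x. indicator (cbox a b) x *\<^sub>R g x)"
    by (subst (asm) integrable_lebesgue_on_iff) auto
  \<comment> \<open>The bump already vanishes outside the open box, so the indicator changes no
    value; it keeps \<open>g\<close>, which is only locally integrable, inside the box and so
    provides an integrable majorant. The limit lives on the open box, whose faces are
    negligible.\<close>
  define s where "s n x = indicator (cbox a b) x *\<^sub>R g x * box_bump a b (real (Suc n)) x" for n x
  have bm: "box_bump a b (real (Suc n)) \<in> borel_measurable lebesgue" for n
  proof -
    have "continuous_on UNIV (box_bump a b (real (Suc n)))"
      by (rule test_functionsD(4)[OF box_bump_test_function[of _ a b UNIV]]) auto
    then have "box_bump a b (real (Suc n)) \<in> borel_measurable lborel"
      by (simp add: borel_measurable_continuous_onI del: of_nat_Suc)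
    then show ?thesis by (rule measurable_completion)
  qed
  have s0: "(LINT x|lebesgue. s n x) = 0" for n
  proof -
    have "(LINT x|lebesgue. s n x) = (LINT x|lebesgue. indicator \<Omega> x *\<^sub>R (g x * box_bump a b (real (Suc n)) x))"
      using sub box_bump_eq_0[of "real (Suc n)" _ a b] box_subset_cbox[of a b]
      by (intro Bochner_Integration.integral_cong) (auto simp: s_def indicator_def)
    also have "\<dots> = (LINT x|lebesgue_on \<Omega>. g x * box_bump a b (real (Suc n)) x)"
      using assms(1) by (subst integral_lebesgue_on_eq) auto
    also have "\<dots> = 0"
      using box_bump_test_function[OF _ sub, of "real (Suc n)"] by (intro orth) auto
    finally show ?thesis .
  qed
  have "(\<lambda>n. LINT x|lebesgue. s n x) \<longlonglongrightarrow> (LINT x|lebesgue. indicator (cbox a b) x *\<^sub>R g x * indicator (box a b) x)"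
  proof (rule integral_dominated_convergence[where w = "\<lambda>x. norm (indicator (cbox a b) x *\<^sub>R g x)"])
    show "(\<lambda>x. indicator (cbox a b) x *\<^sub>R g x * indicator (box a b) x) \<in> borel_measurable lebesgue"
      using gc by (intro borel_measurable_times borel_measurable_integrable borel_measurable_indicator) auto
    show "s n \<in> borel_measurable lebesgue" for n
      unfolding s_def by (intro borel_measurable_times borel_measurable_integrable[OF gc] bm)
    show "AE x in lebesgue. (\<lambda>n. s n x) \<longlonglongrightarrow> indicator (cbox a b) x *\<^sub>R g x * indicator (box a b) x"
      unfolding s_def by (intro AE_I2 tendsto_mult tendsto_const box_bump_tendsto_indicator)
    show "AE x in lebesgue. norm (s n x) \<le> norm (indicator (cbox a b) x *\<^sub>R g x)" for n
      using box_bump_bounds[of a b "real (Suc n)"] unfolding s_def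
      by (intro AE_I2) (simp add: abs_mult mult_left_le del: of_nat_Suc)
  qed (use gc in \<open>rule integrable_norm\<close>)
  then have "(LINT x|lebesgue. indicator (cbox a b) x *\<^sub>R g x * indicator (box a b) x) = 0"
    by (simp add: s0 LIMSEQ_const_iff)
  also have "(\<lambda>x. indicator (cbox a b) x *\<^sub>R g x * indicator (box a b) x) = (\<lambda>x. indicator (box a b) x *\<^sub>R g x)"
    using box_subset_cbox[of a b] by (auto simp: fun_eq_iff indicator_def)
  finally have "(LINT x|lebesgue_on (box a b). g x) = 0"
    by (simp add: integral_lebesgue_on_eq)
  moreover have "integrable (lebesgue_on (box a b)) g"
    using set_integrable_subset[of lebesgue "cbox a b" g "box a b"] gc box_subset_cbox[of a b]
    by (simp only: integrable_lebesgue_on_iff[OF open_sets_lebesgue[OF open_box]] set_integrable_def)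
      (simp add: open_sets_lebesgue)
  ultimately have "integral (box a b) g = 0"
    by (simp add: lebesgue_integral_eq_integral)
  then show ?thesis by (simp add: integral_open_interval)
qed

lemma open_countable_cbox_cover:
  fixes S :: "'a::euclidean_space set"
  assumes "open S"
  shows "\<exists>D. countable D \<and> D \<subseteq> Pow S \<and> (\<forall>X\<in>D. \<exists>a b. X = cbox a b) \<and> \<Union>D = S"
proof (rule open_countable_Union_open_cbox[OF assms])
  fix D assume "countable D" "D \<subseteq> Pow S" "\<And>X. X \<in> D \<Longrightarrow> \<exists>a b. X = cbox a b" "\<Union>D = S"
  then show ?thesis by (intro exI[of _ D] conjI ballI)
qed

text \<open>Lebesgue differentiation: for almost every x the averages of \<open>g\<close> over the
  small cubes \<open>cbox x (x + h *\<^sub>R One)\<close> converge to \<open>g x\<close>, and by the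
  previous lemma all these averages are 0. Countably many boxes exhaust \<open>\<Omega>\<close>, so
  the exceptional sets still add up to a null set.\<close>

lemma AE_eq_0_if_test_orthogonal:
  fixes g :: "'a::euclidean_space \<Rightarrow> real"
  assumes "open \<Omega>" "locally_integrable \<Omega> g"
    and orth: "\<And>\<phi>. \<phi> \<in> test_functions \<Omega> \<Longrightarrow> (LINT x|lebesgue_on \<Omega>. g x * \<phi> x) = 0"
  shows "AE x in lebesgue_on \<Omega>. g x = 0"
proof -
  have box: "\<exists>N. negligible N \<and> (\<forall>x\<in>cbox c d - N. g x = 0)" if sub: "cbox c d \<subseteq> \<Omega>" for c d
  proof -
    define f where "f x = (if x \<in> cbox c d then g x else 0)" for x
    have "integrable (lebesgue_on (cbox c d)) g"
      using assms(2) sub by (simp add: locally_integrable_def)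
    then have "g integrable_on cbox c d"
      by (simp add: integrable_on_lebesgue_on)
    then have "f integrable_on UNIV"
      unfolding f_def by (subst integrable_restrict_UNIV)
    then have "f integrable_on cbox a b" for a b
      by (rule integrable_on_subcbox) simp
    then obtain N where N: "negligible N"
      and lim: "\<And>x e. \<lbrakk>x \<notin> N; 0 < e\<rbrakk> \<Longrightarrow> \<exists>d>0. \<forall>h. 0 < h \<and> h < d \<longrightarrow>
          norm (integral (cbox x (x + h *\<^sub>R One)) f /\<^sub>R h ^ DIM('a) - f x) < e"
      by (rule integrable_ccontinuous_explicit[of f]) blast
    have "g x = 0" if x: "x \<in> box c d" "x \<notin> N" for x
    proof (rule ccontr)
      assume "g x \<noteq> 0"
      with lim[OF x(2), of "\<bar>g x\<bar>"] obtain r where r: "r > 0"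
        "\<And>h. 0 < h \<Longrightarrow> h < r \<Longrightarrow> norm (integral (cbox x (x + h *\<^sub>R One)) f /\<^sub>R h ^ DIM('a) - f x) < \<bar>g x\<bar>"
        by auto
      obtain s where s: "s > 0" "ball x s \<subseteq> box c d"
        using x(1) open_box open_contains_ball by blast
      \<comment> \<open>Small enough for the differentiation estimate (below \<open>r\<close>) and
        for the cube of side \<open>h\<close> at \<open>x\<close> to fit into the ball of radius
        \<open>s\<close>.\<close>
      define h where "h = min (r / 2) (s / (2 * norm (One :: 'a)))"
      have One: "norm (One :: 'a) > 0"
        by (metis One_non_0 zero_less_norm_iff)
      have h: "0 < h" "h < r" "h * norm (One :: 'a) < s"
        using r(1) s(1) One unfolding h_def by (auto simp: min_less_iff_disj) (auto simp: min_def field_simps)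
      have sub': "cbox x (x + h *\<^sub>R One) \<subseteq> box c d"
      proof
        fix y assume y: "y \<in> cbox x (x + h *\<^sub>R One)"
        have "\<bar>(y - x) \<bullet> i\<bar> \<le> \<bar>(h *\<^sub>R One) \<bullet> i\<bar>" if "i \<in> Basis" for i :: 'a
          using y that h(1) by (auto simp: cbox_def inner_diff_left inner_add_left)
        then have "norm (y - x) \<le> norm (h *\<^sub>R (One :: 'a))"
          by (rule norm_le_componentwise)
        then have "y \<in> ball x s" using h by (simp add: dist_norm norm_minus_commute)
        then show "y \<in> box c d" using s(2) by blast
      qed
      have "integral (cbox x (x + h *\<^sub>R One)) f = integral (cbox x (x + h *\<^sub>R One)) g"
        using sub' box_subset_cbox[of c d] by (intro integral_cong) (auto simp: f_def)
      also have "\<dots> = 0"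
        using sub' sub box_subset_cbox[of c d]
        by (intro integral_cbox_eq_0_if_test_orthogonal[OF assms]) auto
      finally show False
        using r(2)[OF h(1,2)] x(1) box_subset_cbox[of c d] by (auto simp: f_def)
    qed
    \<comment> \<open>Cubes fit only around interior points, so the faces of the box join the
      exceptional set.\<close>
    then have "\<forall>x\<in>cbox c d - (N \<union> (cbox c d - box c d)). g x = 0" by blast
    moreover have "negligible (N \<union> (cbox c d - box c d))"
      by (intro negligible_Un N negligible_frontier_interval)
    ultimately show ?thesis by blast
  qed
  obtain D where D: "countable D" "D \<subseteq> Pow \<Omega>" "\<forall>X\<in>D. \<exists>a b. X = cbox a b" "\<Union>D = \<Omega>"
    using open_countable_cbox_cover[OF assms(1)] by (elim exE conjE)
  have "\<forall>X\<in>D. \<exists>N. negligible N \<and> (\<forall>x\<in>X - N. g x = 0)"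
  proof
    fix X assume X: "X \<in> D"
    then obtain c d where "X = cbox c d" using D(3) by blast
    then show "\<exists>N. negligible N \<and> (\<forall>x\<in>X - N. g x = 0)"
      using box[of c d] X D(2) by blast
  qed
  from bchoice[OF this] obtain N where
    N0: "\<forall>X\<in>D. negligible (N X) \<and> (\<forall>x\<in>X - N X. g x = 0)" by blast
  then have N: "\<And>X. X \<in> D \<Longrightarrow> negligible (N X)" "\<And>X x. X \<in> D \<Longrightarrow> x \<in> X - N X \<Longrightarrow> g x = 0"
    by blast+
  have "negligible (\<Union>(N ` D))"
    using N(1) D(1) by (intro negligible_countable_Union) auto
  then have "\<Union>(N ` D) \<in> null_sets lebesgue"
    by (simp add: negligible_iff_null_sets)
  then have "AE x in lebesgue. x \<notin> \<Union>(N ` D)"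
    by (rule AE_not_in)
  then have "AE x in lebesgue. x \<in> \<Omega> \<longrightarrow> g x = 0"
    by (rule eventually_mono) (use N(2) D(4) in blast)
  then show ?thesis
    using assms(1) by (subst AE_restrict_space_iff) auto
qed

text \<open>\<open>g - h\<close> is a weak gradient of u - u, so each of its components is
  orthogonal to all test functions.\<close>

lemma is_weak_grad_unique:
  assumes "open \<Omega>" "is_weak_grad \<Omega> u g" "is_weak_grad \<Omega> u h"
  shows "AE x in lebesgue_on \<Omega>. g x = h x"
proof -
  have "AE x in lebesgue_on \<Omega>. (g x - h x) \<bullet> b = 0" if b: "b \<in> Basis" for b
  proof (rule AE_eq_0_if_test_orthogonal[OF assms(1)])
    have "locally_integrable \<Omega> (\<lambda>x. 1 *\<^sub>R g x + (-1) *\<^sub>R h x)"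
      using assms(2,3) by (intro locally_integrable_lincomb) (auto simp: is_weak_grad_def)
    then show "locally_integrable \<Omega> (\<lambda>x. (g x - h x) \<bullet> b)"
      by (simp add: locally_integrable_def)
    have w: "is_weak_grad \<Omega> (\<lambda>x. 1 * u x + (-1) * u x) (\<lambda>x. 1 *\<^sub>R g x + (-1) *\<^sub>R h x)"
      by (rule is_weak_grad_lincomb[OF assms])
    show "(LINT x|lebesgue_on \<Omega>. (g x - h x) \<bullet> b * \<phi> x) = 0" if "\<phi> \<in> test_functions \<Omega>" for \<phi>
      using w that b by (simp add: is_weak_grad_def)
  qed
  then have "AE x in lebesgue_on \<Omega>. \<forall>b\<in>Basis. (g x - h x) \<bullet> b = 0"
    by (intro AE_finite_allI) auto
  then show ?thesis
    by (rule eventually_mono) (metis eq_iff_diff_eq_0 euclidean_all_zero_iff)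
qed

lemma is_weak_grad_weak_grad: "is_weak_grad \<Omega> u g \<Longrightarrow> is_weak_grad \<Omega> u (weak_grad \<Omega> u)"
  unfolding weak_grad_def by (rule someI[where P = "is_weak_grad \<Omega> u"])

lemma weak_grad_AE_eq:
  "open \<Omega> \<Longrightarrow> is_weak_grad \<Omega> u g \<Longrightarrow> AE x in lebesgue_on \<Omega>. weak_grad \<Omega> u x = g x"
  using is_weak_grad_unique is_weak_grad_weak_grad by blast

section \<open>Morrey's inequality for test functions\<close>

lemma
  fixes h :: "'a::euclidean_space \<Rightarrow> real"
  assumes "integrable lborel h" "t \<noteq> 0"
  shows integrable_lborel_affine: "integrable lborel (\<lambda>y. h (s + t *\<^sub>R y))"
    and integral_lborel_affine: "(LINT y|lborel. h (s + t *\<^sub>R y)) = (LINT y|lborel. h y) / \<bar>t\<bar> ^ DIM('a)"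
proof -
  let ?D = "distr lborel borel (\<lambda>y. s + t *\<^sub>R y)"
  have h: "h \<in> borel_measurable borel" using assms(1) by auto
  have aff: "lborel = density ?D (\<lambda>_. ennreal (\<bar>t\<bar> ^ DIM('a)))"
    using lborel_affine[OF assms(2), of s] by simp
  have "integrable (density ?D (\<lambda>_. ennreal (\<bar>t\<bar> ^ DIM('a)))) h"
    using assms(1) aff by simp
  then have "integrable ?D (\<lambda>y. \<bar>t\<bar> ^ DIM('a) *\<^sub>R h y)"
    using h by (subst (asm) integrable_density) auto
  then have "integrable lborel (\<lambda>y. \<bar>t\<bar> ^ DIM('a) *\<^sub>R h (s + t *\<^sub>R y))"
    using h by (subst (asm) integrable_distr_eq) auto
  then show "integrable lborel (\<lambda>y. h (s + t *\<^sub>R y))"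
    using assms(2) by simp
  have "(LINT y|lborel. h y) = (LINT y|density ?D (\<lambda>_. ennreal (\<bar>t\<bar> ^ DIM('a))). h y)"
    using aff by simp
  also have "\<dots> = (LINT y|?D. \<bar>t\<bar> ^ DIM('a) *\<^sub>R h y)"
    using h by (intro integral_density) auto
  also have "\<dots> = (LINT y|lborel. \<bar>t\<bar> ^ DIM('a) *\<^sub>R h (s + t *\<^sub>R y))"
    using h by (intro integral_distr) auto
  also have "\<dots> = \<bar>t\<bar> ^ DIM('a) * (LINT y|lborel. h (s + t *\<^sub>R y))"
    by simp
  finally show "(LINT y|lborel. h (s + t *\<^sub>R y)) = (LINT y|lborel. h y) / \<bar>t\<bar> ^ DIM('a)"
    using assms(2) by simp
qed

lemma gradient_eq_0_outside:
  assumes "\<phi> \<in> test_functions \<Omega>" "x \<notin> \<Omega>"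
  shows "gradient \<phi> x = 0"
  using test_function_eq_0[OF test_function_partial[OF assms(1)] assms(2)]
  by (simp add: gradient_def)

lemma
  assumes "open \<Omega>" "bounded \<Omega>" "\<phi> \<in> test_functions \<Omega>" "m > 0"
  shows integrable_gradient_powr: "integrable lborel (\<lambda>x. norm (gradient \<phi> x) powr m)"
    and integral_gradient_powr:
      "(LINT x|lebesgue_on \<Omega>. norm (gradient \<phi> x) powr m) = (LINT x|lborel. norm (gradient \<phi> x) powr m)"
proof -
  let ?h = "\<lambda>x. norm (gradient \<phi> x) powr m"
  have cont: "continuous_on UNIV ?h"
    using assms(4) by (intro continuous_on_powr' continuous_intros continuous_on_gradient[OF assms(3)]) auto
  have "integrable lborel (\<lambda>x. indicator (closure \<Omega>) x *\<^sub>R ?h x)"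
    using assms(2) cont by (intro borel_integrable_compact) (auto intro: continuous_on_subset)
  moreover have "(\<lambda>x. indicator (closure \<Omega>) x *\<^sub>R ?h x) = ?h"
  proof
    fix x show "indicator (closure \<Omega>) x *\<^sub>R ?h x = ?h x"
      using gradient_eq_0_outside[OF assms(3), of x] closure_subset[of \<Omega>]
      by (cases "x \<in> \<Omega>") (auto simp: subset_iff)
  qed
  ultimately show i: "integrable lborel ?h" by (simp only:)
  have eq: "(\<lambda>x. indicator \<Omega> x *\<^sub>R ?h x) = ?h"
  proof
    fix x show "indicator \<Omega> x *\<^sub>R ?h x = ?h x"
      using gradient_eq_0_outside[OF assms(3), of x] by (cases "x \<in> \<Omega>") auto
  qed
  have "(LINT x|lebesgue_on \<Omega>. ?h x) = (LINT x|lebesgue. indicator \<Omega> x *\<^sub>R ?h x)"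
    by (rule integral_lebesgue_on_eq[OF open_sets_lebesgue[OF assms(1)]])
  also have "\<dots> = (LINT x|lborel. ?h x)"
    unfolding eq by (rule integral_completion[OF borel_measurable_integrable[OF i]])
  finally show "(LINT x|lebesgue_on \<Omega>. ?h x) = (LINT x|lborel. ?h x)" .
qed

text \<open>Integrated with a suitable \<open>\<delta>\<close>, this replaces Hoelder's inequality.\<close>

lemma le_add_powr:
  fixes a \<delta> m :: real
  assumes "a \<ge> 0" "\<delta> > 0" "m > 1"
  shows "a \<le> \<delta> + \<delta> powr (1 - m) * a powr m"
proof (cases "a \<le> \<delta>")
  case False
  then have "a > 0" using assms by simp
  have "a = a powr (1 - m) * a powr m"
    using \<open>a > 0\<close> by (simp flip: powr_add)
  also have "\<dots> \<le> \<delta> powr (1 - m) * a powr m"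
    using False assms by (intro mult_right_mono powr_mono2') auto
  finally show ?thesis using assms by simp
qed (use assms in \<open>simp add: add_increasing2\<close>)

text \<open>Averages \<open>\<integral>\<^sub>Q \<phi> (x + t (y - x)) dy\<close> over a unit box \<open>Q\<close> outside the domain interpolate between
  \<open>\<phi> x\<close> at \<open>t = 0\<close> and \<open>0\<close> at \<open>t = 1\<close>; their \<open>t\<close>-derivative is of order
  \<open>t\<close> to the power \<open>- DIM('a) / m\<close>, which is integrable near \<open>0\<close> because \<open>m > DIM('a)\<close>.\<close>

lemma morrey_test_function:
  fixes \<Omega> :: "'a::euclidean_space set"
    and m :: real
  assumes "open \<Omega>" "bounded \<Omega>" "m > DIM('a)"
  obtains C where "C > 0"
    "\<And>\<phi> G x. \<phi> \<in> test_functions \<Omega> \<Longrightarrow> G > 0 \<Longrightarrow>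
       (LINT x|lebesgue_on \<Omega>. norm (gradient \<phi> x) powr m) \<le> G powr m \<Longrightarrow> x \<in> \<Omega> \<Longrightarrow> \<bar>\<phi> x\<bar> \<le> C * G"
proof -
  have N1: "real DIM('a) \<ge> 1" by (simp add: Suc_leI)
  then have m1: "m > 1" using assms(3) by linarith
  obtain R where R: "R > 0" "\<Omega> \<subseteq> ball 0 R"
    using bounded_subset_ballD[OF assms(2), of 0] by blast
  obtain b0 :: 'a where b0: "b0 \<in> Basis" using nonempty_Basis by blast
  \<comment> \<open>The box lies beyond the hyperplane \<open>y \<bullet> b0 = R\<close>, hence
    outside the ball that contains \<open>\<Omega>\<close>; its content 1 makes integrals over it
    averages.\<close>
  define Q where "Q = cbox (R *\<^sub>R b0) (R *\<^sub>R b0 + One)"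
  have content_Q: "measure lborel Q = 1"
    unfolding Q_def by (subst content_cbox) (auto simp: inner_add_left)
  have Q_out: "y \<notin> \<Omega>" if "y \<in> Q" for y
  proof -
    have "R \<le> y \<bullet> b0" using that b0 by (auto simp: Q_def mem_box)
    also have "\<dots> \<le> norm y" using Basis_le_norm[OF b0, of y] by linarith
    finally show ?thesis using R(2) by auto
  qed
  obtain B where B: "B > 0" "\<And>y. y \<in> Q \<Longrightarrow> norm y \<le> B"
    using bounded_cbox[of "R *\<^sub>R b0" "R *\<^sub>R b0 + One"] unfolding Q_def bounded_pos by auto
  define D where "D = B + R"
  have D: "D > 0" "\<And>x y. x \<in> \<Omega> \<Longrightarrow> y \<in> Q \<Longrightarrow> norm (y - x) \<le> D"
  proof -
    show "D > 0" using B(1) R(1) by (simp add: D_def)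
    fix x y assume "x \<in> \<Omega>" "y \<in> Q"
    then have "norm x < R" "norm y \<le> B" using R(2) B(2) by auto
    then show "norm (y - x) \<le> D" using norm_triangle_ineq4[of y x] by (simp add: D_def)
  qed
  define \<kappa> where "\<kappa> = 1 - DIM('a) / m"
  have \<kappa>: "\<kappa> > 0" using assms(3) m1 by (simp add: \<kappa>_def)
  \<comment> \<open>The integral of the derivative bound 2 D G t^(\<kappa> - 1) over [0, 1] is (2 D
    / \<kappa>) G.\<close>
  define C where "C = 2 * D / \<kappa>"
  have "C > 0" using D(1) \<kappa> by (simp add: C_def)
  moreover have "\<bar>\<phi> x\<bar> \<le> C * G"
    if phi: "\<phi> \<in> test_functions \<Omega>" and G: "G > 0" and
      le: "(LINT x|lebesgue_on \<Omega>. norm (gradient \<phi> x) powr m) \<le> G powr m" and x: "x \<in> \<Omega>" for \<phi> G x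
  proof -
    define h where "h z = norm (gradient \<phi> z) powr m" for z
    define F where "F t = integral Q (\<lambda>y. \<phi> (x + t *\<^sub>R (y - x)))" for t
    define F' where "F' t = integral Q (\<lambda>y. gradient \<phi> (x + t *\<^sub>R (y - x)) \<bullet> (y - x))" for t
    have h_cont: "continuous_on S h" for S
      unfolding h_def using m1 by (intro continuous_on_powr' continuous_intros continuous_on_gradient[OF phi]) auto
    have h_int: "integrable lborel h" "(LINT z|lborel. h z) \<le> G powr m"
      using integrable_gradient_powr[OF assms(1,2) phi, of m] integral_gradient_powr[OF assms(1,2) phi, of m] m1 le
      by (simp_all add: h_def[abs_def])
    have Fderiv: "(F has_real_derivative F' t) (at t within {0..1})" if "t \<in> {0..1}" for t
      unfolding F_def[abs_def] F'_def Q_def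
    proof (rule leibniz_rule_field_derivative[OF _ _ _ that])
      show "((\<lambda>t. \<phi> (x + t *\<^sub>R (y - x))) has_real_derivative gradient \<phi> (x + t *\<^sub>R (y - x)) \<bullet> (y - x))
          (at t within {0..1})" for t y
        using has_derivative_test_function_line[OF phi, of x "y - x" t]
        by (simp add: gradient_inner[OF test_functionsD(5)[OF phi]])
      show "(\<lambda>y. \<phi> (x + t *\<^sub>R (y - x))) integrable_on cbox (R *\<^sub>R b0) (R *\<^sub>R b0 + One)" for t
        by (intro integrable_continuous continuous_on_compose2[OF test_functionsD(4)[OF phi, of UNIV]]
            continuous_intros) auto
      show "continuous_on ({0..1} \<times> cbox (R *\<^sub>R b0) (R *\<^sub>R b0 + One))
          (\<lambda>(t, y). gradient \<phi> (x + t *\<^sub>R (y - x)) \<bullet> (y - x))"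
        unfolding split_def
        by (intro continuous_on_inner continuous_on_compose2[OF continuous_on_gradient[OF phi, of UNIV]]
            continuous_intros) auto
    qed auto
    have bound: "\<bar>F' t\<bar> \<le> 2 * D * G * t powr (\<kappa> - 1)" if t: "0 < t" "t < 1" for t
    proof -
      \<comment> \<open>The value balancing the two terms of \<open>le_add_powr\<close>: the
        substitution z = x + t (y - x) costs t^(-N) with N = \<open>DIM('a)\<close>, and this
        \<open>\<delta>\<close> solves \<delta>^(1-m) G^m t^(-N) = \<delta>.\<close>
      define \<delta> where "\<delta> = t powr (- (DIM('a) / m)) * G"
      have \<delta>: "\<delta> > 0" using t G by (simp add: \<delta>_def)
      define k where "k y = h (x + t *\<^sub>R (y - x))" for y
      have k_cont: "continuous_on S k" for S
        unfolding k_def by (intro continuous_on_compose2[OF h_cont[of UNIV]] continuous_intros) auto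
      have k_eq: "k = (\<lambda>y. h ((x - t *\<^sub>R x) + t *\<^sub>R y))"
        by (auto simp: k_def fun_eq_iff algebra_simps)
      have k_int: "integrable lborel k" "(LINT y|lborel. k y) = (LINT y|lborel. h y) / t ^ DIM('a)"
        unfolding k_eq using integrable_lborel_affine[OF h_int(1), of t] integral_lborel_affine[OF h_int(1), of t] t
        by auto
      have "\<bar>F' t\<bar> \<le> integral Q (\<lambda>y. D * (\<delta> + \<delta> powr (1 - m) * k y))"
        unfolding F'_def real_norm_def[symmetric]
      proof (rule integral_norm_bound_integral)
        show "(\<lambda>y. gradient \<phi> (x + t *\<^sub>R (y - x)) \<bullet> (y - x)) integrable_on Q"
          unfolding Q_def
          by (intro integrable_continuous continuous_on_inner
              continuous_on_compose2[OF continuous_on_gradient[OF phi, of UNIV]] continuous_intros) auto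
        show "(\<lambda>y. D * (\<delta> + \<delta> powr (1 - m) * k y)) integrable_on Q"
          unfolding Q_def by (intro integrable_continuous continuous_intros k_cont)
        fix y assume y: "y \<in> Q"
        let ?g = "gradient \<phi> (x + t *\<^sub>R (y - x))"
        have "norm (?g \<bullet> (y - x)) \<le> norm ?g * norm (y - x)"
          using Cauchy_Schwarz_ineq2 by simp
        also have "\<dots> \<le> norm ?g * D"
          using D(2)[OF x y] by (intro mult_left_mono) auto
        also have "\<dots> \<le> (\<delta> + \<delta> powr (1 - m) * norm ?g powr m) * D"
          using le_add_powr[of "norm ?g" \<delta> m] \<delta> m1 D(1) by (intro mult_right_mono) auto
        finally show "norm (?g \<bullet> (y - x)) \<le> D * (\<delta> + \<delta> powr (1 - m) * k y)"
          by (simp add: k_def h_def mult.commute)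
      qed
      also have "\<dots> = D * (\<delta> + \<delta> powr (1 - m) * integral Q k)"
      proof -
        have "k integrable_on Q" unfolding Q_def by (intro integrable_continuous k_cont)
        then have "integral Q (\<lambda>y. \<delta> + \<delta> powr (1 - m) * k y) = integral Q (\<lambda>y. \<delta>) + integral Q (\<lambda>y. \<delta> powr (1 - m) * k y)"
          unfolding Q_def by (intro integral_add integrable_const integrable_on_mult_right)
        also have "integral Q (\<lambda>y. \<delta>) = \<delta>"
          using content_Q unfolding Q_def by (subst integral_const) simp
        finally show ?thesis by simp
      qed
      also have "\<dots> \<le> D * (\<delta> + \<delta> powr (1 - m) * (G powr m / t ^ DIM('a)))"
      proof -
        have "integral Q k \<le> integral UNIV k"
          unfolding Q_def using integrable_on_lborel[OF k_int(1)]
          by (intro integral_subset_le integrable_continuous k_cont) (auto simp: k_def h_def)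
        also have "\<dots> = (LINT y|lborel. h y) / t ^ DIM('a)"
          using integral_lborel[OF k_int(1)] k_int(2) by simp
        also have "\<dots> \<le> G powr m / t ^ DIM('a)"
          using h_int(2) t by (intro divide_right_mono) auto
        finally show ?thesis
          using D(1) by (intro mult_left_mono add_left_mono) auto
      qed
      also have "\<delta> powr (1 - m) * (G powr m / t ^ DIM('a)) = \<delta>"
      proof -
        have "\<delta> powr (1 - m) = t powr (- (DIM('a) / m) * (1 - m)) * G powr (1 - m)"
          using t G unfolding \<delta>_def by (simp add: powr_mult powr_powr)
        then have "\<delta> powr (1 - m) * (G powr m / t ^ DIM('a)) =
            (t powr (- (DIM('a) / m) * (1 - m)) * t powr (- real DIM('a))) * (G powr (1 - m) * G powr m)"
          using t by (simp add: powr_minus powr_realpow divide_inverse)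
        also have "\<dots> = t powr (- (DIM('a) / m) * (1 - m) + (- real DIM('a))) * G powr 1"
          by (simp flip: powr_add)
        also have "- (DIM('a) / m) * (1 - m) + (- real DIM('a)) = - (DIM('a) / m)"
          using m1 by (simp add: field_simps)
        finally show ?thesis using G by (simp add: \<delta>_def)
      qed
      also have "D * (\<delta> + \<delta>) = 2 * D * G * t powr (\<kappa> - 1)"
        by (simp add: \<delta>_def \<kappa>_def)
      finally show ?thesis .
    qed
    have "norm (F 1 - F 0) \<le> C * G * 1 powr \<kappa> - C * G * 0 powr \<kappa>"
    \<comment> \<open>The bound on \<open>F'\<close> is singular at t = 0, but this mean value
      estimate asks for derivatives only inside the interval, and the primitive C G t^\<kappa> is
      continuous at 0.\<close>
    proof (rule differentiable_bound_general[where f' = F' and \<phi>' = "\<lambda>t. 2 * D * G * t powr (\<kappa> - 1)"])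
      show "continuous_on {0..1} F"
        using Fderiv DERIV_continuous_on by blast
      show "continuous_on {0..1} (\<lambda>t. C * G * t powr \<kappa>)"
        using \<kappa> by (intro continuous_intros continuous_on_powr') auto
      fix t :: real assume t: "0 < t" "t < 1"
      then show "(F has_vector_derivative F' t) (at t)"
        using Fderiv[of t] at_within_interior[of t "{0..1}"]
        by (simp add: has_real_derivative_iff_has_vector_derivative)
      have "((\<lambda>t. C * G * t powr \<kappa>) has_real_derivative C * G * (\<kappa> * t powr (\<kappa> - 1))) (at t)"
        using t by (intro DERIV_cmult has_real_derivative_powr) auto
      then show "((\<lambda>t. C * G * t powr \<kappa>) has_vector_derivative 2 * D * G * t powr (\<kappa> - 1)) (at t)"
        using \<kappa> by (simp add: has_real_derivative_iff_has_vector_derivative C_def mult.assoc)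
      show "norm (F' t) \<le> 2 * D * G * t powr (\<kappa> - 1)"
        using bound[OF t] by simp
    qed simp
    moreover have "F 0 = \<phi> x"
      using content_Q unfolding F_def Q_def by simp
    moreover have "F 1 = 0"
    proof -
      have "F 1 = integral Q (\<lambda>_. 0)"
        unfolding F_def using test_function_eq_0[OF phi Q_out] by (intro integral_cong) simp
      then show ?thesis by simp
    qed
    ultimately show ?thesis using \<kappa> by simp
  qed
  ultimately show ?thesis by (rule that)
qed

section \<open>Sobolev functions with zero boundary values\<close>

text \<open>The s-th power of the norm: an integral that can be differentiated and compared
  directly, with no root in the way.\<close>

definition Lp_mass :: "'a::euclidean_space set \<Rightarrow> real \<Rightarrow> ('a \<Rightarrow> 'b::euclidean_space) \<Rightarrow> real" where
  "Lp_mass \<Omega> s f = (LINT x|lebesgue_on \<Omega>. norm (f x) powr s)"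

lemma Lp_mass_nonneg: "Lp_mass \<Omega> s f \<ge> 0"
  by (simp add: Lp_mass_def)

lemma Lp_norm_powr: "s > 0 \<Longrightarrow> Lp_norm \<Omega> s f powr s = Lp_mass \<Omega> s f"
  using Lp_mass_nonneg[of \<Omega> s f] by (simp add: Lp_norm_def Lp_mass_def powr_powr)

lemma Lp_norm_less_iff:
  assumes "s > 0" "e > 0"
  shows "Lp_norm \<Omega> s f < e \<longleftrightarrow> Lp_mass \<Omega> s f < e powr s"
proof -
  have "Lp_norm \<Omega> s f \<ge> 0" by (simp add: Lp_norm_def)
  then show ?thesis
    using assms powr_less_mono2[of s "Lp_norm \<Omega> s f" e] powr_mono2[of s e "Lp_norm \<Omega> s f"]
    unfolding Lp_norm_powr[OF assms(1), symmetric] by linarith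
qed

text \<open>A stand-in for Minkowski's inequality: the norm of a + b is at most twice the larger
  norm, and the s-th power of the larger norm is at most the sum of both. The factor
  \<open>2 powr s\<close> is harmless where only integrability or smallness is at stake.\<close>

lemma norm_add_powr_le:
  fixes a b :: "'b::real_normed_vector"
  assumes "s > 0"
  shows "norm (a + b) powr s \<le> 2 powr s * (norm a powr s + norm b powr s)"
proof -
  have "norm (a + b) \<le> 2 * max (norm a) (norm b)"
    using norm_triangle_ineq[of a b] by (simp add: max_def)
  then have "norm (a + b) powr s \<le> (2 * max (norm a) (norm b)) powr s"
    using assms by (intro powr_mono2) auto
  also have "\<dots> = 2 powr s * max (norm a) (norm b) powr s"
    by (rule powr_mult)
  also have "max (norm a) (norm b) powr s \<le> norm a powr s + norm b powr s"
    by (simp add: max_def)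
  finally show ?thesis by simp
qed

lemma
  assumes "in_Lp \<Omega> s f" "in_Lp \<Omega> s g" "s > 0"
  shows in_Lp_add: "in_Lp \<Omega> s (\<lambda>x. f x + g x)"
    and Lp_mass_add_le: "Lp_mass \<Omega> s (\<lambda>x. f x + g x) \<le> 2 powr s * (Lp_mass \<Omega> s f + Lp_mass \<Omega> s g)"
proof -
  have [measurable]: "f \<in> borel_measurable (lebesgue_on \<Omega>)" "g \<in> borel_measurable (lebesgue_on \<Omega>)"
    using assms by (auto simp: in_Lp_def)
  have fg: "integrable (lebesgue_on \<Omega>) (\<lambda>x. norm (f x) powr s)" "integrable (lebesgue_on \<Omega>) (\<lambda>x. norm (g x) powr s)"
    using assms by (auto simp: in_Lp_def)
  then have i: "integrable (lebesgue_on \<Omega>) (\<lambda>x. 2 powr s * (norm (f x) powr s + norm (g x) powr s))"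
    by simp
  have j: "integrable (lebesgue_on \<Omega>) (\<lambda>x. norm (f x + g x) powr s)"
  proof (rule Bochner_Integration.integrable_bound[OF i])
    show "(\<lambda>x. norm (f x + g x) powr s) \<in> borel_measurable (lebesgue_on \<Omega>)"
      by measurable
    show "AE x in lebesgue_on \<Omega>. norm (norm (f x + g x) powr s) \<le> norm (2 powr s * (norm (f x) powr s + norm (g x) powr s))"
    proof (rule AE_I2)
      fix x show "norm (norm (f x + g x) powr s) \<le> norm (2 powr s * (norm (f x) powr s + norm (g x) powr s))"
        using norm_add_powr_le[OF assms(3), of "f x" "g x"] by (simp add: abs_of_nonneg)
    qed
  qed
  then show "in_Lp \<Omega> s (\<lambda>x. f x + g x)"
    by (simp add: in_Lp_def)
  have "Lp_mass \<Omega> s (\<lambda>x. f x + g x) \<le> (LINT x|lebesgue_on \<Omega>. 2 powr s * (norm (f x) powr s + norm (g x) powr s))"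
    unfolding Lp_mass_def by (intro integral_mono i j norm_add_powr_le assms)
  also have "\<dots> = 2 powr s * (Lp_mass \<Omega> s f + Lp_mass \<Omega> s g)"
    using fg by (simp add: Lp_mass_def)
  finally show "Lp_mass \<Omega> s (\<lambda>x. f x + g x) \<le> 2 powr s * (Lp_mass \<Omega> s f + Lp_mass \<Omega> s g)" .
qed

lemma
  assumes "in_Lp \<Omega> s f"
  shows in_Lp_scale: "in_Lp \<Omega> s (\<lambda>x. c *\<^sub>R f x)"
    and Lp_mass_scale: "Lp_mass \<Omega> s (\<lambda>x. c *\<^sub>R f x) = \<bar>c\<bar> powr s * Lp_mass \<Omega> s f"
  using assms by (auto simp: in_Lp_def Lp_mass_def powr_mult)

lemma
  assumes "in_Lp \<Omega> s f" "in_Lp \<Omega> s g" "s > 0"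
  shows in_Lp_lincomb: "in_Lp \<Omega> s (\<lambda>x. \<alpha> *\<^sub>R f x + \<beta> *\<^sub>R g x)"
    and Lp_mass_lincomb_le: "Lp_mass \<Omega> s (\<lambda>x. \<alpha> *\<^sub>R f x + \<beta> *\<^sub>R g x) \<le>
      2 powr s * (\<bar>\<alpha>\<bar> powr s * Lp_mass \<Omega> s f + \<bar>\<beta>\<bar> powr s * Lp_mass \<Omega> s g)"
  using in_Lp_add[OF in_Lp_scale[OF assms(1), of \<alpha>] in_Lp_scale[OF assms(2), of \<beta>] assms(3)]
    Lp_mass_add_le[OF in_Lp_scale[OF assms(1), of \<alpha>] in_Lp_scale[OF assms(2), of \<beta>] assms(3)]
    Lp_mass_scale[OF assms(1), of \<alpha>] Lp_mass_scale[OF assms(2), of \<beta>]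
  by simp_all

lemma
  assumes "f \<in> borel_measurable (lebesgue_on \<Omega>)" "g \<in> borel_measurable (lebesgue_on \<Omega>)"
    and "AE x in lebesgue_on \<Omega>. f x = g x"
  shows in_Lp_cong_AE: "in_Lp \<Omega> s f \<longleftrightarrow> in_Lp \<Omega> s g"
    and Lp_mass_cong_AE: "Lp_mass \<Omega> s f = Lp_mass \<Omega> s g"
proof -
  have [measurable]: "f \<in> borel_measurable (lebesgue_on \<Omega>)" "g \<in> borel_measurable (lebesgue_on \<Omega>)"
    by fact+
  have ae: "AE x in lebesgue_on \<Omega>. norm (f x) powr s = norm (g x) powr s"
    using assms(3) by (rule eventually_mono) simp
  show "in_Lp \<Omega> s f \<longleftrightarrow> in_Lp \<Omega> s g"
    unfolding in_Lp_def using assms(1,2) by (intro conj_cong integrable_cong_AE ae) auto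
  show "Lp_mass \<Omega> s f = Lp_mass \<Omega> s g"
    unfolding Lp_mass_def by (intro integral_cong_AE ae) auto
qed

text \<open>Exchanging gradients that agree almost everywhere under an integral requires
  measurability, which \<open>is_weak_grad\<close> provides only on compact pieces; countably many
  boxes and the complement of \<open>\<Omega>\<close> glue them.\<close>

lemma locally_integrable_measurable:
  fixes f :: "'a::euclidean_space \<Rightarrow> 'b::euclidean_space"
  assumes "open \<Omega>" "locally_integrable \<Omega> f"
  shows "f \<in> borel_measurable (lebesgue_on \<Omega>)"
proof (rule borel_measurable_if_D)
  let ?f = "\<lambda>x. if x \<in> \<Omega> then f x else 0"
  obtain D where D: "countable D" "D \<subseteq> Pow \<Omega>" "\<forall>X\<in>D. \<exists>a b. X = cbox a b" "\<Union>D = \<Omega>"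
    using open_countable_cbox_cover[OF assms(1)] by (elim exE conjE)
  show "?f \<in> borel_measurable lebesgue"
  proof (rule measurable_piecewise_restrict[of "insert (- \<Omega>) D"])
    show "countable (insert (- \<Omega>) D)" using D(1) by simp
    show "space lebesgue \<subseteq> \<Union> (insert (- \<Omega>) D)" using D(4) by auto
    fix X assume "X \<in> insert (- \<Omega>) D"
    then consider "X = - \<Omega>" | "X \<in> D" by blast
    then have "X \<in> sets lebesgue \<and> ?f \<in> borel_measurable (lebesgue_on X)"
    proof cases
      case 1
      then have "X \<in> sets lebesgue" using assms(1) by simp
      moreover have "(\<lambda>x. 0) \<in> borel_measurable (lebesgue_on X)" by simp
      then have "?f \<in> borel_measurable (lebesgue_on X)"
        by (rule measurable_cong[THEN iffD1, rotated]) (use 1 in simp)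
      ultimately show ?thesis by simp
    next
      case 2
      then obtain a b where X: "X = cbox a b" using D(3) by blast
      have sub: "X \<subseteq> \<Omega>" using 2 D(2) by blast
      then have "integrable (lebesgue_on X) f"
        using assms(2) X by (simp add: locally_integrable_def)
      then have "f \<in> borel_measurable (lebesgue_on X)" by simp
      then have "?f \<in> borel_measurable (lebesgue_on X)"
        by (rule measurable_cong[THEN iffD1, rotated]) (use sub in auto)
      then show ?thesis using X by simp
    qed
    then show "X \<inter> space lebesgue \<in> sets lebesgue" "?f \<in> borel_measurable (lebesgue_on X)"
      by simp_all
  qed
qed

section \<open>Sobolev functions and the chosen weak gradient\<close>

lemma is_weak_grad_measurable:
  "open \<Omega> \<Longrightarrow> is_weak_grad \<Omega> u g \<Longrightarrow> g \<in> borel_measurable (lebesgue_on \<Omega>)"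
  by (intro locally_integrable_measurable) (simp_all add: is_weak_grad_def)

text \<open>\<open>W1\<close> promises some weak gradient in the Lebesgue space; uniqueness almost
  everywhere passes this on to the one picked by \<open>weak_grad\<close>.\<close>

lemma W1D:
  assumes "open \<Omega>" "u \<in> W1 \<Omega> s"
  shows "in_Lp \<Omega> s u" "is_weak_grad \<Omega> u (weak_grad \<Omega> u)" "in_Lp \<Omega> s (weak_grad \<Omega> u)"
proof -
  obtain g where g: "is_weak_grad \<Omega> u g" "in_Lp \<Omega> s g"
    using assms(2) unfolding W1_def by blast
  show "in_Lp \<Omega> s u" using assms(2) by (simp add: W1_def)
  show w: "is_weak_grad \<Omega> u (weak_grad \<Omega> u)" using g(1) by (rule is_weak_grad_weak_grad)
  show "in_Lp \<Omega> s (weak_grad \<Omega> u)"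
    using g(2) in_Lp_cong_AE[OF is_weak_grad_measurable[OF assms(1) w] is_weak_grad_measurable[OF assms(1) g(1)]
        weak_grad_AE_eq[OF assms(1) g(1)]] by simp
qed

lemma W1_lincomb:
  assumes "open \<Omega>" "u \<in> W1 \<Omega> s" "v \<in> W1 \<Omega> s" "s > 0"
  shows "(\<lambda>x. \<alpha> * u x + \<beta> * v x) \<in> W1 \<Omega> s"
  using in_Lp_lincomb[OF W1D(1)[OF assms(1,2)] W1D(1)[OF assms(1,3)] assms(4), of \<alpha> \<beta>]
    is_weak_grad_lincomb[OF assms(1) W1D(2)[OF assms(1,2)] W1D(2)[OF assms(1,3)], of \<alpha> \<beta>]
    in_Lp_lincomb[OF W1D(3)[OF assms(1,2)] W1D(3)[OF assms(1,3)] assms(4), of \<alpha> \<beta>]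
  unfolding W1_def by auto

lemma weak_grad_lincomb_AE:
  assumes "open \<Omega>" "u \<in> W1 \<Omega> s" "v \<in> W1 \<Omega> s"
  shows "AE x in lebesgue_on \<Omega>. weak_grad \<Omega> (\<lambda>x. \<alpha> * u x + \<beta> * v x) x =
    \<alpha> *\<^sub>R weak_grad \<Omega> u x + \<beta> *\<^sub>R weak_grad \<Omega> v x"
  by (rule weak_grad_AE_eq[OF assms(1) is_weak_grad_lincomb[OF assms(1) W1D(2)[OF assms(1,2)] W1D(2)[OF assms(1,3)]]])

text \<open>The exponents \<open>r\<close> and \<open>s\<close> are independent, since the weak
  gradient does not depend on the exponent; the energy combines two of them.\<close>

lemma Lp_mass_weak_grad_lincomb:
  assumes "open \<Omega>" "u \<in> W1 \<Omega> s" "v \<in> W1 \<Omega> s"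
  shows "Lp_mass \<Omega> r (weak_grad \<Omega> (\<lambda>x. \<alpha> * u x + \<beta> * v x)) =
    Lp_mass \<Omega> r (\<lambda>x. \<alpha> *\<^sub>R weak_grad \<Omega> u x + \<beta> *\<^sub>R weak_grad \<Omega> v x)"
proof (rule Lp_mass_cong_AE[OF _ _ weak_grad_lincomb_AE[OF assms]])
  note g = is_weak_grad_lincomb[OF assms(1) W1D(2)[OF assms(1,2)] W1D(2)[OF assms(1,3)], of \<alpha> \<beta>]
  show "(\<lambda>x. \<alpha> *\<^sub>R weak_grad \<Omega> u x + \<beta> *\<^sub>R weak_grad \<Omega> v x) \<in> borel_measurable (lebesgue_on \<Omega>)"
    by (rule is_weak_grad_measurable[OF assms(1) g])
  show "weak_grad \<Omega> (\<lambda>x. \<alpha> * u x + \<beta> * v x) \<in> borel_measurable (lebesgue_on \<Omega>)"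
    by (rule is_weak_grad_measurable[OF assms(1) is_weak_grad_weak_grad[OF g]])
qed

lemma in_Lp_bounded_continuous:
  fixes f :: "'a::euclidean_space \<Rightarrow> 'b::euclidean_space"
  assumes "open \<Omega>" "bounded \<Omega>" "continuous_on (closure \<Omega>) f" "s > 0"
  shows "in_Lp \<Omega> s f"
proof -
  have cp: "compact (closure \<Omega>)" using assms(2) by simp
  have "continuous_on (closure \<Omega>) (\<lambda>x. norm (f x) powr s)"
    using assms(3,4) by (intro continuous_on_powr' continuous_intros) auto
  then have "integrable (lebesgue_on (closure \<Omega>)) (\<lambda>x. norm (f x) powr s)"
    using continuous_imp_locally_integrable[of "closure \<Omega>" "\<lambda>x. norm (f x) powr s"] cp
    by (simp add: locally_integrable_def)
  then have "set_integrable lebesgue (closure \<Omega>) (\<lambda>x. norm (f x) powr s)"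
    by (simp only: set_integrable_def integrable_lebesgue_on_iff[OF compact_sets_lebesgue[OF cp]])
  then have "set_integrable lebesgue \<Omega> (\<lambda>x. norm (f x) powr s)"
    by (rule set_integrable_subset[OF _ open_sets_lebesgue[OF assms(1)] closure_subset])
  then have "integrable (lebesgue_on \<Omega>) (\<lambda>x. norm (f x) powr s)"
    by (simp only: set_integrable_def integrable_lebesgue_on_iff[OF open_sets_lebesgue[OF assms(1)]])
  moreover have "f \<in> borel_measurable (lebesgue_on \<Omega>)"
    using assms(1) continuous_on_subset[OF assms(3) closure_subset]
    by (intro continuous_imp_measurable_on_sets_lebesgue) auto
  ultimately show ?thesis by (simp add: in_Lp_def)
qed

lemma test_function_W1:
  assumes "open \<Omega>" "bounded \<Omega>" "\<phi> \<in> test_functions \<Omega>" "s > 0"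
  shows "\<phi> \<in> W1 \<Omega> s"
  unfolding W1_def
  using in_Lp_bounded_continuous[OF assms(1,2) test_functionsD(4)[OF assms(3)] assms(4)]
    in_Lp_bounded_continuous[OF assms(1,2) continuous_on_gradient[OF assms(3)] assms(4)]
    is_weak_grad_test_function[OF assms(1,3)] by blast

lemma Lp_mass_weak_grad_test_function:
  assumes "open \<Omega>" "\<phi> \<in> test_functions \<Omega>"
  shows "Lp_mass \<Omega> r (weak_grad \<Omega> \<phi>) = Lp_mass \<Omega> r (gradient \<phi>)"
proof -
  note g = is_weak_grad_test_function[OF assms]
  show ?thesis
    by (rule Lp_mass_cong_AE[OF is_weak_grad_measurable[OF assms(1) is_weak_grad_weak_grad[OF g]]
          is_weak_grad_measurable[OF assms(1) g] weak_grad_AE_eq[OF assms(1) g]])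
qed

section \<open>The closure of the test functions and its boundary values\<close>

lemma W01_iff:
  assumes "s > 0"
  shows "u \<in> W01 \<Omega> s \<longleftrightarrow> u \<in> W1 \<Omega> s \<and> (\<forall>\<epsilon>>0. \<exists>\<phi>\<in>test_functions \<Omega>.
    Lp_mass \<Omega> s (\<lambda>x. u x - \<phi> x) < \<epsilon> \<and> Lp_mass \<Omega> s (weak_grad \<Omega> (\<lambda>x. u x - \<phi> x)) < \<epsilon>)"
  (is "_ \<longleftrightarrow> _ \<and> ?R")
proof -
  have nn: "Lp_norm \<Omega> s f \<ge> 0" for f :: "'a \<Rightarrow> 'b::euclidean_space" by (simp add: Lp_norm_def)
  have "(\<forall>\<epsilon>>0. \<exists>\<phi>\<in>test_functions \<Omega>. W1_norm \<Omega> s (\<lambda>x. u x - \<phi> x) < \<epsilon>) \<longleftrightarrow> ?R"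
  proof
    assume L: "\<forall>\<epsilon>>0. \<exists>\<phi>\<in>test_functions \<Omega>. W1_norm \<Omega> s (\<lambda>x. u x - \<phi> x) < \<epsilon>"
    show ?R
    proof (intro allI impI)
      fix \<epsilon> :: real assume e: "\<epsilon> > 0"
      define \<delta> where "\<delta> = \<epsilon> powr (1 / s)"
      have \<delta>: "\<delta> > 0" "\<delta> powr s = \<epsilon>" using e assms by (auto simp: \<delta>_def powr_powr)
      obtain \<phi> where phi: "\<phi> \<in> test_functions \<Omega>" "W1_norm \<Omega> s (\<lambda>x. u x - \<phi> x) < \<delta>"
        using L \<delta>(1) by blast
      have "Lp_norm \<Omega> s (\<lambda>x. u x - \<phi> x) < \<delta>" "Lp_norm \<Omega> s (weak_grad \<Omega> (\<lambda>x. u x - \<phi> x)) < \<delta>"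
        using phi(2) nn[of "\<lambda>x. u x - \<phi> x"] nn[of "weak_grad \<Omega> (\<lambda>x. u x - \<phi> x)"]
        unfolding W1_norm_def by linarith+
      then show "\<exists>\<phi>\<in>test_functions \<Omega>. Lp_mass \<Omega> s (\<lambda>x. u x - \<phi> x) < \<epsilon> \<and>
          Lp_mass \<Omega> s (weak_grad \<Omega> (\<lambda>x. u x - \<phi> x)) < \<epsilon>"
        using phi(1) \<delta> by (intro bexI[of _ \<phi>]) (simp_all add: Lp_norm_less_iff[OF assms])
    qed
  next
    assume R: ?R
    show "\<forall>\<epsilon>>0. \<exists>\<phi>\<in>test_functions \<Omega>. W1_norm \<Omega> s (\<lambda>x. u x - \<phi> x) < \<epsilon>"
    proof (intro allI impI)
      fix \<epsilon> :: real assume e: "\<epsilon> > 0"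
      then have "(\<epsilon> / 2) powr s > 0" by simp
      then obtain \<phi> where phi: "\<phi> \<in> test_functions \<Omega>" "Lp_mass \<Omega> s (\<lambda>x. u x - \<phi> x) < (\<epsilon> / 2) powr s"
          "Lp_mass \<Omega> s (weak_grad \<Omega> (\<lambda>x. u x - \<phi> x)) < (\<epsilon> / 2) powr s"
        using R by blast
      then have "Lp_norm \<Omega> s (\<lambda>x. u x - \<phi> x) < \<epsilon> / 2" "Lp_norm \<Omega> s (weak_grad \<Omega> (\<lambda>x. u x - \<phi> x)) < \<epsilon> / 2"
        by (simp_all only: Lp_norm_less_iff[OF assms half_gt_zero[OF e]])
      then have "W1_norm \<Omega> s (\<lambda>x. u x - \<phi> x) < \<epsilon>"
        unfolding W1_norm_def by linarith
      then show "\<exists>\<phi>\<in>test_functions \<Omega>. W1_norm \<Omega> s (\<lambda>x. u x - \<phi> x) < \<epsilon>"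
        using phi(1) by blast
    qed
  qed
  then show ?thesis unfolding W01_def by blast
qed

lemma W01_imp_W1: "u \<in> W01 \<Omega> s \<Longrightarrow> u \<in> W1 \<Omega> s"
  by (simp add: W01_def)

lemma test_function_W01:
  assumes "open \<Omega>" "bounded \<Omega>" "\<phi> \<in> test_functions \<Omega>" "s > 0"
  shows "\<phi> \<in> W01 \<Omega> s"
  unfolding W01_iff[OF assms(4)]
proof (intro conjI allI impI bexI)
  \<comment> \<open>A test function approximates itself, but the chosen weak gradient of the zero
    function vanishes only almost everywhere, hence the detour through its classical
    gradient.\<close>
  have "Lp_mass \<Omega> s (weak_grad \<Omega> (\<lambda>x::'a. 0)) = Lp_mass \<Omega> s (gradient (\<lambda>x::'a. 0))"
    by (rule Lp_mass_weak_grad_test_function[OF assms(1) test_function_0])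
  also have "gradient (\<lambda>x::'a. 0) = (\<lambda>x. 0)"
    by (auto simp: gradient_def fun_eq_iff frechet_derivative_eq[of _ "\<lambda>_. 0"])
  finally have z: "Lp_mass \<Omega> s (weak_grad \<Omega> (\<lambda>x::'a. 0)) = 0"
    by (simp add: Lp_mass_def)
  fix \<epsilon> :: real assume "\<epsilon> > 0"
  then show "Lp_mass \<Omega> s (\<lambda>x. \<phi> x - \<phi> x) < \<epsilon>" "Lp_mass \<Omega> s (weak_grad \<Omega> (\<lambda>x. \<phi> x - \<phi> x)) < \<epsilon>"
    using z by (simp_all add: Lp_mass_def)
qed (use assms test_function_W1 in auto)

lemma W01_lincomb:
  assumes "open \<Omega>" "bounded \<Omega>" "u \<in> W01 \<Omega> s" "v \<in> W01 \<Omega> s" "s > 0"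
  shows "(\<lambda>x. \<alpha> * u x + \<beta> * v x) \<in> W01 \<Omega> s"
  unfolding W01_iff[OF assms(5)]
proof (intro conjI allI impI)
  note uW = W01_imp_W1[OF assms(3)] and vW = W01_imp_W1[OF assms(4)]
  show "(\<lambda>x. \<alpha> * u x + \<beta> * v x) \<in> W1 \<Omega> s"
    by (rule W1_lincomb[OF assms(1) uW vW assms(5)])
  fix \<epsilon> :: real assume e: "\<epsilon> > 0"
  \<comment> \<open>The summand 1 makes \<open>M\<close> positive even for
    \<open>\<alpha> = \<beta> = 0\<close> and turns the final estimate into a strict one.\<close>
  define M where "M = 2 powr s * (\<bar>\<alpha>\<bar> powr s + \<bar>\<beta>\<bar> powr s) + 1"
  have M: "M > 0" by (simp add: M_def add_nonneg_pos)
  have small: "2 powr s * (\<bar>\<alpha>\<bar> powr s * a + \<bar>\<beta>\<bar> powr s * b) < \<epsilon>"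
    if "a < \<epsilon> / M" "b < \<epsilon> / M" for a b
  proof -
    have "2 powr s * (\<bar>\<alpha>\<bar> powr s * a + \<bar>\<beta>\<bar> powr s * b) \<le>
        2 powr s * (\<bar>\<alpha>\<bar> powr s * (\<epsilon> / M) + \<bar>\<beta>\<bar> powr s * (\<epsilon> / M))"
      using that by (intro mult_left_mono add_mono) auto
    also have "\<dots> = (2 powr s * (\<bar>\<alpha>\<bar> powr s + \<bar>\<beta>\<bar> powr s)) * (\<epsilon> / M)"
      by (simp only: distrib_left distrib_right mult.assoc)
    also have "\<dots> = (M - 1) * (\<epsilon> / M)"
      by (simp add: M_def)
    also have "\<dots> < M * (\<epsilon> / M)"
      using e M by (intro mult_strict_right_mono) auto
    finally show ?thesis using M by simp
  qed
  have eM: "\<epsilon> / M > 0" using e M by simp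
  obtain \<phi> where phi: "\<phi> \<in> test_functions \<Omega>" "Lp_mass \<Omega> s (\<lambda>x. u x - \<phi> x) < \<epsilon> / M"
    "Lp_mass \<Omega> s (weak_grad \<Omega> (\<lambda>x. u x - \<phi> x)) < \<epsilon> / M"
    using assms(3) eM unfolding W01_iff[OF assms(5)] by blast
  obtain \<psi> where psi: "\<psi> \<in> test_functions \<Omega>" "Lp_mass \<Omega> s (\<lambda>x. v x - \<psi> x) < \<epsilon> / M"
    "Lp_mass \<Omega> s (weak_grad \<Omega> (\<lambda>x. v x - \<psi> x)) < \<epsilon> / M"
    using assms(4) eM unfolding W01_iff[OF assms(5)] by blast
  let ?a = "\<lambda>x. u x - \<phi> x" and ?b = "\<lambda>x. v x - \<psi> x"
  have aW: "?a \<in> W1 \<Omega> s"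
    using W1_lincomb[OF assms(1) uW test_function_W1[OF assms(1,2) phi(1) assms(5)] assms(5), of 1 "-1"] by simp
  have bW: "?b \<in> W1 \<Omega> s"
    using W1_lincomb[OF assms(1) vW test_function_W1[OF assms(1,2) psi(1) assms(5)] assms(5), of 1 "-1"] by simp
  have eq: "(\<lambda>x. \<alpha> * u x + \<beta> * v x - (\<alpha> * \<phi> x + \<beta> * \<psi> x)) = (\<lambda>x. \<alpha> * ?a x + \<beta> * ?b x)"
    by (auto simp: fun_eq_iff algebra_simps)
  have "Lp_mass \<Omega> s (\<lambda>x. \<alpha> * ?a x + \<beta> * ?b x) < \<epsilon>"
    using Lp_mass_lincomb_le[OF W1D(1)[OF assms(1) aW] W1D(1)[OF assms(1) bW] assms(5), of \<alpha> \<beta>]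
      small[OF phi(2) psi(2)] by simp
  moreover have "Lp_mass \<Omega> s (weak_grad \<Omega> (\<lambda>x. \<alpha> * ?a x + \<beta> * ?b x)) < \<epsilon>"
    unfolding Lp_mass_weak_grad_lincomb[OF assms(1) aW bW]
    using Lp_mass_lincomb_le[OF W1D(3)[OF assms(1) aW] W1D(3)[OF assms(1) bW] assms(5), of \<alpha> \<beta>]
      small[OF phi(3) psi(3)] by simp
  ultimately show "\<exists>\<phi>\<in>test_functions \<Omega>. Lp_mass \<Omega> s (\<lambda>x. \<alpha> * u x + \<beta> * v x - \<phi> x) < \<epsilon> \<and>
      Lp_mass \<Omega> s (weak_grad \<Omega> (\<lambda>x. \<alpha> * u x + \<beta> * v x - \<phi> x)) < \<epsilon>"
    unfolding eq[symmetric]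
    by (intro bexI[of _ "\<lambda>x. \<alpha> * \<phi> x + \<beta> * \<psi> x"] conjI test_function_add test_function_scale phi(1) psi(1))
qed

text \<open>If the bound failed at a point, it would fail by a fixed amount on a ball, where test functions
  close to \<open>w\<close> obey it.\<close>

lemma morrey_W01:
  fixes \<Omega> :: "'a::euclidean_space set" and m :: real
  assumes "open \<Omega>" "bounded \<Omega>" "m > DIM('a)"
  obtains C where "C > 0"
    "\<And>w G x. w \<in> W01 \<Omega> m \<Longrightarrow> continuous_on \<Omega> w \<Longrightarrow> G > 0 \<Longrightarrow>
       2 powr m * Lp_mass \<Omega> m (weak_grad \<Omega> w) < G powr m \<Longrightarrow> x \<in> \<Omega> \<Longrightarrow> \<bar>w x\<bar> \<le> C * G"
proof -
  have m0: "m > 0" using assms(3) by linarith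
  obtain C where C: "C > 0"
    "\<And>\<phi> G x. \<phi> \<in> test_functions \<Omega> \<Longrightarrow> G > 0 \<Longrightarrow>
       (LINT x|lebesgue_on \<Omega>. norm (gradient \<phi> x) powr m) \<le> G powr m \<Longrightarrow> x \<in> \<Omega> \<Longrightarrow> \<bar>\<phi> x\<bar> \<le> C * G"
    using morrey_test_function[OF assms] by metis
  have "\<bar>w x\<bar> \<le> C * G"
    if w: "w \<in> W01 \<Omega> m" "continuous_on \<Omega> w" and G: "G > 0"
      and le: "2 powr m * Lp_mass \<Omega> m (weak_grad \<Omega> w) < G powr m" and x: "x \<in> \<Omega>" for w G x
  proof (rule ccontr)
    assume "\<not> \<bar>w x\<bar> \<le> C * G"
    define \<delta> where "\<delta> = (\<bar>w x\<bar> - C * G) / 2"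
    have "2 * (r / 2) = r" for r :: real by simp
    then have \<delta>: "\<delta> > 0" "\<bar>w x\<bar> = C * G + 2 * \<delta>"
      using \<open>\<not> \<bar>w x\<bar> \<le> C * G\<close> by (simp_all only: \<delta>_def) simp_all
    obtain r1 where r1: "r1 > 0" "ball x r1 \<subseteq> \<Omega>"
      using assms(1) x open_contains_ball by blast
    obtain r2 where r2: "r2 > 0" "\<forall>y\<in>\<Omega>. dist y x < r2 \<longrightarrow> dist (w y) (w x) < \<delta>"
      using w(2) x \<delta>(1) unfolding continuous_on_iff by blast
    define B where "B = ball x (min r1 r2)"
    have B: "B \<subseteq> \<Omega>" "B \<in> sets lebesgue"
      using r1 by (auto simp: B_def)
    have wB: "\<bar>w y\<bar> > C * G + \<delta>" if "y \<in> B" for y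
    proof -
      have "dist y x < r2" "y \<in> \<Omega>" using that B by (auto simp: B_def dist_commute)
      then have "\<bar>w y - w x\<bar> < \<delta>" using r2(2) by (simp add: dist_real_def)
      then show ?thesis using \<delta>(2) by linarith
    qed
    have Bpos: "measure lebesgue B > 0"
      unfolding B_def using r1(1) r2(1) content_ball_pos[of "min r1 r2" x] by (simp add: measure_completion)
    \<comment> \<open>The first entry keeps the gradient integral of \<open>\<phi>\<close> below
      \<open>G powr m\<close>, so that the bound for test functions applies to it. The second is the
      least mass that a gap of at least \<open>\<delta>\<close> between \<open>w\<close> and
      \<open>\<phi>\<close> on all of \<open>B\<close> would produce.\<close>
    define \<epsilon> where "\<epsilon> = min ((G powr m - 2 powr m * Lp_mass \<Omega> m (weak_grad \<Omega> w)) / 2 powr m) (\<delta> powr m * measure lebesgue B)"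
    have "\<epsilon> > 0" using le \<delta>(1) Bpos by (simp add: \<epsilon>_def)
    then obtain \<phi> where phi: "\<phi> \<in> test_functions \<Omega>" "Lp_mass \<Omega> m (\<lambda>x. w x - \<phi> x) < \<epsilon>"
      "Lp_mass \<Omega> m (weak_grad \<Omega> (\<lambda>x. w x - \<phi> x)) < \<epsilon>"
      using w(1) unfolding W01_iff[OF m0] by blast
    let ?d = "\<lambda>x. w x - \<phi> x"
    have dW: "?d \<in> W1 \<Omega> m"
      using W1_lincomb[OF assms(1) W01_imp_W1[OF w(1)] test_function_W1[OF assms(1,2) phi(1) m0] m0, of 1 "-1"] by simp
    \<comment> \<open>Writing \<open>\<phi>\<close> as w minus the error bounds its gradient by the
      quasi-triangle inequality, which is where the factor \<open>2 powr m\<close> of the hypothesis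
      comes from.\<close>
    have "(\<lambda>x. 1 * w x + (-1) * ?d x) = \<phi>" by auto
    then have "Lp_mass \<Omega> m (gradient \<phi>) =
        Lp_mass \<Omega> m (\<lambda>x. 1 *\<^sub>R weak_grad \<Omega> w x + (-1) *\<^sub>R weak_grad \<Omega> ?d x)"
      using Lp_mass_weak_grad_lincomb[OF assms(1) W01_imp_W1[OF w(1)] dW, of m 1 "-1"]
        Lp_mass_weak_grad_test_function[OF assms(1) phi(1), of m] by simp
    also have "\<dots> \<le> 2 powr m * (\<bar>1\<bar> powr m * Lp_mass \<Omega> m (weak_grad \<Omega> w) + \<bar>-1\<bar> powr m * Lp_mass \<Omega> m (weak_grad \<Omega> ?d))"
      by (rule Lp_mass_lincomb_le[OF W1D(3)[OF assms(1) W01_imp_W1[OF w(1)]] W1D(3)[OF assms(1) dW] m0])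
    also have "\<dots> \<le> 2 powr m * Lp_mass \<Omega> m (weak_grad \<Omega> w) + 2 powr m * \<epsilon>"
      using phi(3) by (simp add: algebra_simps)
    also have "2 powr m * \<epsilon> \<le> G powr m - 2 powr m * Lp_mass \<Omega> m (weak_grad \<Omega> w)"
    proof -
      have "\<epsilon> \<le> (G powr m - 2 powr m * Lp_mass \<Omega> m (weak_grad \<Omega> w)) / 2 powr m"
        by (simp add: \<epsilon>_def)
      then show ?thesis by (simp add: field_simps)
    qed
    finally have "Lp_mass \<Omega> m (gradient \<phi>) \<le> G powr m" by simp
    then have phi_le: "\<bar>\<phi> y\<bar> \<le> C * G" if "y \<in> \<Omega>" for y
      using C(2)[OF phi(1) G _ that] by (simp add: Lp_mass_def)
    have di: "integrable (lebesgue_on \<Omega>) (\<lambda>x. norm (?d x) powr m)"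
      using W1D(1)[OF assms(1) dW] by (simp add: in_Lp_def)
    have lm: "B \<in> lmeasurable" by (simp add: B_def)
    have "\<delta> powr m * measure lebesgue B = (LINT x|lebesgue. \<delta> powr m * indicator B x)"
      using lm by simp
    also have "\<dots> \<le> (LINT x|lebesgue. indicator \<Omega> x *\<^sub>R norm (?d x) powr m)"
    proof (rule integral_mono)
      show "integrable lebesgue (\<lambda>x. \<delta> powr m * indicator B x)"
        by (intro integrable_mult_right integrable_real_indicator) (use lm in \<open>auto simp: fmeasurable_def\<close>)
      show "integrable lebesgue (\<lambda>x. indicator \<Omega> x *\<^sub>R norm (?d x) powr m)"
        using di by (simp only: integrable_lebesgue_on_iff[OF open_sets_lebesgue[OF assms(1)]])
      fix y
      show "\<delta> powr m * indicator B y \<le> indicator \<Omega> y *\<^sub>R norm (?d y) powr m"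
      proof (cases "y \<in> B")
        case True
        then have y: "y \<in> \<Omega>" using B by blast
        have "\<delta> \<le> \<bar>?d y\<bar>" using wB[OF True] phi_le[OF y] by linarith
        then have "\<delta> powr m \<le> \<bar>?d y\<bar> powr m" using \<delta>(1) m0 by (intro powr_mono2) auto
        then show ?thesis using True y by simp
      qed simp
    qed
    also have "\<dots> = Lp_mass \<Omega> m ?d"
      unfolding Lp_mass_def by (rule integral_lebesgue_on_eq[OF open_sets_lebesgue[OF assms(1)], symmetric])
    also have "\<dots> < \<epsilon>" by (rule phi(2))
    also have "\<epsilon> \<le> \<delta> powr m * measure lebesgue B" by (simp add: \<epsilon>_def)
    finally show False by simp
  qed
  with C(1) show ?thesis by (rule that)
qed

text \<open>Morrey's bound for u - \<phi>, with a test function \<phi> close to u, extends to the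
  closure by continuity; on the frontier \<phi> is 0, so the bound there is one for u
  itself.\<close>

lemma W01_eq_0_frontier:
  fixes \<Omega> :: "'a::euclidean_space set" and m :: real
  assumes "open \<Omega>" "bounded \<Omega>" "m > DIM('a)"
    and u: "u \<in> W01 \<Omega> m" "continuous_on (closure \<Omega>) u" and x: "x \<in> frontier \<Omega>"
  shows "u x = 0"
proof (rule ccontr)
  assume "u x \<noteq> 0"
  have m0: "m > 0" using assms(3) by linarith
  obtain C where C: "C > 0"
    "\<And>w G x. w \<in> W01 \<Omega> m \<Longrightarrow> continuous_on \<Omega> w \<Longrightarrow> G > 0 \<Longrightarrow>
       2 powr m * Lp_mass \<Omega> m (weak_grad \<Omega> w) < G powr m \<Longrightarrow> x \<in> \<Omega> \<Longrightarrow> \<bar>w x\<bar> \<le> C * G"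
    using morrey_W01[OF assms(1-3)] by metis
  \<comment> \<open>With this choice the bound \<open>C * G\<close> is half of the absolute value of
    \<open>u x\<close>, a contradiction.\<close>
  define G where "G = \<bar>u x\<bar> / (2 * C)"
  have G: "G > 0" using C(1) \<open>u x \<noteq> 0\<close> by (simp add: G_def)
  then have "G powr m / 2 powr m > 0" by simp
  then obtain \<phi> where phi: "\<phi> \<in> test_functions \<Omega>"
    "Lp_mass \<Omega> m (weak_grad \<Omega> (\<lambda>x. u x - \<phi> x)) < G powr m / 2 powr m"
    using u(1) unfolding W01_iff[OF m0] by blast
  have W: "(\<lambda>x. u x - \<phi> x) \<in> W01 \<Omega> m"
    using W01_lincomb[OF assms(1,2) u(1) test_function_W01[OF assms(1,2) phi(1) m0] m0, of 1 "-1"] by simp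
  have cont: "continuous_on (closure \<Omega>) (\<lambda>x. u x - \<phi> x)"
    by (intro continuous_intros u(2) test_functionsD(4)[OF phi(1)])
  have "2 powr m * Lp_mass \<Omega> m (weak_grad \<Omega> (\<lambda>x. u x - \<phi> x)) < G powr m"
    using phi(2) by (simp add: field_simps)
  then have "\<forall>y\<in>\<Omega>. norm (u y - \<phi> y) \<le> C * G"
    using C(2)[OF W continuous_on_subset[OF cont closure_subset] G] by simp
  moreover have "x \<in> closure \<Omega>" using x by (simp add: frontier_def)
  ultimately have "norm (u x - \<phi> x) \<le> C * G"
    by (rule continuous_on_closure_norm_le[OF cont])
  moreover have "\<phi> x = 0"
    using x assms(1) test_function_eq_0[OF phi(1), of x] by (simp add: frontier_def interior_open)
  ultimately show False
    using C(1) \<open>u x \<noteq> 0\<close> by (simp add: G_def)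
qed

section \<open>The essential supremum of a continuous function\<close>

lemma continuous_AE_le:
  fixes w :: "'a::euclidean_space \<Rightarrow> real"
  assumes "open \<Omega>" "continuous_on \<Omega> w" "AE y in lebesgue_on \<Omega>. \<bar>w y\<bar> \<le> c" "x \<in> \<Omega>"
  shows "\<bar>w x\<bar> \<le> c"
proof (rule ccontr)
  assume "\<not> \<bar>w x\<bar> \<le> c"
  then have c: "\<bar>w x\<bar> - c > 0" by simp
  have "continuous_on \<Omega> (\<lambda>x. \<bar>w x\<bar>)" using assms(2) by (intro continuous_intros)
  then obtain r2 where r2: "r2 > 0" "\<forall>y\<in>\<Omega>. dist y x < r2 \<longrightarrow> dist \<bar>w y\<bar> \<bar>w x\<bar> < \<bar>w x\<bar> - c"
    using assms(4) c unfolding continuous_on_iff by blast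
  obtain r1 where r1: "r1 > 0" "ball x r1 \<subseteq> \<Omega>"
    using assms(1,4) open_contains_ball by blast
  define B where "B = ball x (min r1 r2)"
  have "AE y in lebesgue. y \<in> \<Omega> \<longrightarrow> \<bar>w y\<bar> \<le> c"
    using assms(1,3) by (subst (asm) AE_restrict_space_iff) auto
  then have "AE y in lebesgue. y \<notin> B"
  proof (rule eventually_mono)
    fix y assume y: "y \<in> \<Omega> \<longrightarrow> \<bar>w y\<bar> \<le> c"
    show "y \<notin> B"
    proof
      assume "y \<in> B"
      then have "dist y x < r2" "y \<in> \<Omega>" using r1 by (auto simp: B_def dist_commute)
      then have "dist \<bar>w y\<bar> \<bar>w x\<bar> < \<bar>w x\<bar> - c" "\<bar>w y\<bar> \<le> c" using r2(2) y by blast+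
      then show False unfolding dist_real_def by linarith
    qed
  qed
  then have "B \<in> null_sets lebesgue"
    by (subst (asm) AE_iff_null_sets[symmetric]) (auto simp: B_def)
  then have "measure lebesgue B = 0" by (simp add: measure_eq_0_null_sets)
  moreover have "measure lebesgue B > 0"
    unfolding B_def using r1(1) r2(1) content_ball_pos[of "min r1 r2" x] by (simp add: measure_completion)
  ultimately show False by simp
qed

lemma
  fixes w :: "'a::euclidean_space \<Rightarrow> real"
  assumes "open \<Omega>" "\<Omega> \<noteq> {}" "bounded \<Omega>" "continuous_on (closure \<Omega>) w"
  shows Linf_norm_le: "(\<And>x. x \<in> \<Omega> \<Longrightarrow> \<bar>w x\<bar> \<le> M) \<Longrightarrow> Linf_norm \<Omega> w \<le> M"
    and Linf_norm_ge: "x \<in> \<Omega> \<Longrightarrow> \<bar>w x\<bar> \<le> Linf_norm \<Omega> w"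
proof -
  have cont: "continuous_on \<Omega> w"
    using assms(4) closure_subset by (rule continuous_on_subset)
  define e where "e = esssup (lebesgue_on \<Omega>) (\<lambda>x. ereal \<bar>w x\<bar>)"
  have m: "(\<lambda>x. ereal \<bar>w x\<bar>) \<in> borel_measurable (lebesgue_on \<Omega>)"
    using continuous_imp_measurable_on_sets_lebesgue[OF cont open_sets_lebesgue[OF assms(1)]] by measurable
  have up: "e \<le> ereal M" if "\<And>x. x \<in> \<Omega> \<Longrightarrow> \<bar>w x\<bar> \<le> M" for M
    unfolding e_def by (rule esssup_I[OF m], rule AE_I2) (use that in simp)
  have lo: "ereal \<bar>w x\<bar> \<le> e" if x: "x \<in> \<Omega>" for x
  proof (rule ccontr)
    assume "\<not> ereal \<bar>w x\<bar> \<le> e"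
    then have "e < ereal \<bar>w x\<bar>" by simp
    then obtain c where c: "e < ereal c" "ereal c < ereal \<bar>w x\<bar>"
      using ereal_dense2 by metis
    have "AE y in lebesgue_on \<Omega>. ereal \<bar>w y\<bar> \<le> e"
      unfolding e_def by (rule esssup_AE)
    then have "AE y in lebesgue_on \<Omega>. \<bar>w y\<bar> \<le> c"
    proof (rule eventually_mono)
      fix y assume "ereal \<bar>w y\<bar> \<le> e"
      then have "ereal \<bar>w y\<bar> < ereal c" using c(1) by (rule le_less_trans)
      then show "\<bar>w y\<bar> \<le> c" by simp
    qed
    then have "\<bar>w x\<bar> \<le> c" by (rule continuous_AE_le[OF assms(1) cont _ x])
    then show False using c(2) by simp
  qed
  \<comment> \<open>\<open>real_of_ereal\<close> sends infinite values to 0, so \<open>e\<close>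
    must be known to be finite before the two bounds can be read off in the reals.\<close>
  have "bounded (w ` closure \<Omega>)"
    using assms(3,4) by (intro compact_imp_bounded compact_continuous_image) auto
  then obtain B where B: "\<forall>x\<in>closure \<Omega>. \<bar>w x\<bar> \<le> B"
    unfolding bounded_iff by auto
  have upB: "e \<le> ereal B" by (rule up) (use B closure_subset in blast)
  obtain x0 where "x0 \<in> \<Omega>" using assms(2) by blast
  then obtain r where r: "e = ereal r" using lo[of x0] upB by (cases e) auto
  then have L: "Linf_norm \<Omega> w = r" by (simp add: Linf_norm_def e_def)
  show "Linf_norm \<Omega> w \<le> M" if "\<And>x. x \<in> \<Omega> \<Longrightarrow> \<bar>w x\<bar> \<le> M" using up[OF that] r L by simp
  show "\<bar>w x\<bar> \<le> Linf_norm \<Omega> w" if "x \<in> \<Omega>" using lo[OF that] r L by simp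
qed

section \<open>Differentiability of the Dirichlet integrals\<close>

text \<open>Where the line passes through 0, the function is the p-th power of the distance in t, up
  to a factor, so its derivative is 0 as p > 1. The formula agrees: the inner product vanishes
  there, whatever the sign of p - 2.\<close>

lemma has_real_derivative_norm_powr_line:
  fixes a b :: "'b::real_inner"
  assumes "p > 1"
  shows "((\<lambda>t. norm (a + t *\<^sub>R b) powr p) has_real_derivative
    p * (norm (a + t *\<^sub>R b) powr (p - 2) * ((a + t *\<^sub>R b) \<bullet> b))) (at t)"
proof (cases "a + t *\<^sub>R b = 0")
  case False
  have "((\<lambda>t. norm (a + t *\<^sub>R b)) has_derivative (\<lambda>s. (s *\<^sub>R b) \<bullet> sgn (a + t *\<^sub>R b))) (at t)"
    by (rule has_derivative_compose[of "\<lambda>t. a + t *\<^sub>R b" "\<lambda>s. s *\<^sub>R b" t UNIV norm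
          "\<lambda>h. h \<bullet> sgn (a + t *\<^sub>R b)", OF _ has_derivative_norm[OF False]])
      (auto intro!: derivative_eq_intros)
  then have D: "((\<lambda>t. norm (a + t *\<^sub>R b)) has_real_derivative b \<bullet> sgn (a + t *\<^sub>R b)) (at t)"
    by (simp add: has_field_derivative_def mult_commute_abs)
  have eq: "p * norm (a + t *\<^sub>R b) powr (p - 1) * (b \<bullet> sgn (a + t *\<^sub>R b)) =
      p * (norm (a + t *\<^sub>R b) powr (p - 2) * ((a + t *\<^sub>R b) \<bullet> b))"
  proof -
    have "norm (a + t *\<^sub>R b) powr (p - 1) = norm (a + t *\<^sub>R b) powr (p - 2) * norm (a + t *\<^sub>R b)"
      using False powr_add[of "norm (a + t *\<^sub>R b)" "p - 2" 1] by simp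
    moreover have "b \<bullet> sgn (a + t *\<^sub>R b) = ((a + t *\<^sub>R b) \<bullet> b) / norm (a + t *\<^sub>R b)"
      by (simp add: sgn_div_norm inner_commute divide_inverse)
    ultimately show ?thesis using False by simp
  qed
  show ?thesis
    using DERIV_fun_powr[OF D, of p] False unfolding eq[symmetric] by simp
next
  case True
  have "((\<lambda>s::real. norm b powr p * \<bar>s\<bar> powr (p - 1)) \<longlongrightarrow> norm b powr p * \<bar>0\<bar> powr (p - 1)) (at 0)"
    by (intro tendsto_intros tendsto_powr'[of _ _ _ "\<lambda>_. p - 1"]) (use assms in auto)
  then have lim: "((\<lambda>s::real. norm b powr p * \<bar>s\<bar> powr (p - 1)) \<longlongrightarrow> 0) (at 0)"
    by simp
  have "((\<lambda>s. (norm (a + (t + s) *\<^sub>R b) powr p - norm (a + t *\<^sub>R b) powr p) / s) \<longlongrightarrow> 0) (at 0)"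
  proof (rule Lim_null_comparison[OF _ lim])
    show "\<forall>\<^sub>F s in at 0. norm ((norm (a + (t + s) *\<^sub>R b) powr p - norm (a + t *\<^sub>R b) powr p) / s)
        \<le> norm b powr p * \<bar>s\<bar> powr (p - 1)"
      unfolding eventually_at_filter
    proof (intro always_eventually allI impI)
      fix s :: real assume s: "s \<noteq> 0"
      have "a + (t + s) *\<^sub>R b = s *\<^sub>R b"
        using True by (simp add: scaleR_add_left flip: add.assoc)
      then have "norm ((norm (a + (t + s) *\<^sub>R b) powr p - norm (a + t *\<^sub>R b) powr p) / s) =
          norm b powr p * (\<bar>s\<bar> powr p / \<bar>s\<bar>)"
        using True by (simp add: powr_mult abs_mult)
      also have "\<bar>s\<bar> powr p / \<bar>s\<bar> = \<bar>s\<bar> powr (p - 1)"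
        using s by (simp add: powr_diff)
      finally show "norm ((norm (a + (t + s) *\<^sub>R b) powr p - norm (a + t *\<^sub>R b) powr p) / s)
          \<le> norm b powr p * \<bar>s\<bar> powr (p - 1)" by simp
    qed
  qed
  then show ?thesis
    using True by (simp add: DERIV_def)
qed

text \<open>Supplies a majorant of the difference quotients that does not depend on t: the mean
  value theorem with the derivative bounded by p times the p-th power of the sum of the norms of a
  and b.\<close>

lemma norm_powr_line_diff_le:
  fixes a b :: "'b::real_inner"
  assumes "p > 1" "\<bar>t\<bar> \<le> 1"
  shows "\<bar>norm (a + t *\<^sub>R b) powr p - norm a powr p\<bar> \<le> p * (2 powr p * (norm a powr p + norm b powr p)) * \<bar>t\<bar>"
proof -
  have "norm (norm (a + t *\<^sub>R b) powr p - norm (a + 0 *\<^sub>R b) powr p) \<le>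
      p * (2 powr p * (norm a powr p + norm b powr p)) * norm (t - 0)"
  proof (rule field_differentiable_bound[where S = "{-1..1}"
        and f' = "\<lambda>t. p * (norm (a + t *\<^sub>R b) powr (p - 2) * ((a + t *\<^sub>R b) \<bullet> b))"])
    fix s :: real assume s: "s \<in> {-1..1}"
    show "((\<lambda>t. norm (a + t *\<^sub>R b) powr p) has_real_derivative
        p * (norm (a + s *\<^sub>R b) powr (p - 2) * ((a + s *\<^sub>R b) \<bullet> b))) (at s within {-1..1})"
      by (rule has_field_derivative_at_within[OF has_real_derivative_norm_powr_line[OF assms(1)]])
    let ?w = "a + s *\<^sub>R b" and ?M = "norm a + norm b"
    have "norm (s *\<^sub>R b) \<le> norm b" using s by (auto intro: mult_left_le_one_le)
    then have w: "norm ?w \<le> ?M" using norm_triangle_ineq[of a "s *\<^sub>R b"] by linarith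
    have "norm ?w powr (p - 2) * \<bar>?w \<bullet> b\<bar> \<le> norm ?w powr (p - 2) * (norm ?w * norm b)"
      by (intro mult_left_mono Cauchy_Schwarz_ineq2) auto
    also have "\<dots> = norm ?w powr (p - 1) * norm b"
    proof (cases "norm ?w = 0")
      case False
      then show ?thesis using powr_add[of "norm ?w" "p - 2" 1] by simp
    qed simp
    also have "\<dots> \<le> ?M powr (p - 1) * ?M"
      using w assms(1) by (intro mult_mono powr_mono2) auto
    also have "\<dots> = ?M powr p"
    proof (cases "?M = 0")
      case False
      then have "?M > 0" by (simp add: less_le)
      then show ?thesis using powr_add[of ?M "p - 1" 1] by simp
    next
      case True
      show ?thesis by (simp only: True) simp
    qed
    also have "\<dots> \<le> 2 powr p * (norm a powr p + norm b powr p)"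
      using norm_add_powr_le[of p "norm a" "norm b"] assms(1) by simp
    finally show "norm (p * (norm ?w powr (p - 2) * (?w \<bullet> b))) \<le> p * (2 powr p * (norm a powr p + norm b powr p))"
      using assms(1) by (simp add: abs_mult)
  qed (use assms(2) in auto)
  then show ?thesis by simp
qed

lemma
  fixes g h :: "'a::euclidean_space \<Rightarrow> 'b::euclidean_space"
  assumes g: "in_Lp \<Omega> p g" and h: "in_Lp \<Omega> p h" and p: "p > 1"
  shows integrable_Lp_mass_derivative:
      "integrable (lebesgue_on \<Omega>) (\<lambda>x. norm (g x) powr (p - 2) * (g x \<bullet> h x))"
    and has_real_derivative_Lp_mass:
      "((\<lambda>t. Lp_mass \<Omega> p (\<lambda>x. g x + t *\<^sub>R h x)) has_real_derivative
        p * (LINT x|lebesgue_on \<Omega>. norm (g x) powr (p - 2) * (g x \<bullet> h x))) (at 0)"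
proof -
  let ?M = "lebesgue_on \<Omega>"
  have [measurable]: "g \<in> borel_measurable ?M" "h \<in> borel_measurable ?M"
    using g h by (auto simp: in_Lp_def)
  define W where "W x = p * (2 powr p * (norm (g x) powr p + norm (h x) powr p))" for x
  have W: "integrable ?M W"
    using g h unfolding in_Lp_def W_def[abs_def]
    by (intro integrable_mult_right Bochner_Integration.integrable_add) auto
  define D where "D x = norm (g x) powr (p - 2) * (g x \<bullet> h x)" for x
  define Q where "Q t x = (norm (g x + t *\<^sub>R h x) powr p - norm (g x) powr p) / t" for t x
  have QM: "Q t \<in> borel_measurable ?M" for t
    unfolding Q_def[abs_def] by measurable
  have DM: "(\<lambda>x. p * D x) \<in> borel_measurable ?M"
    unfolding D_def[abs_def] by measurable
  have Qb: "norm (Q t x) \<le> W x" if "\<bar>t\<bar> \<le> 1" for t x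
  proof (cases "t = 0")
    case True
    then show ?thesis using p by (simp add: Q_def W_def)
  next
    case False
    have "norm (Q t x) = \<bar>norm (g x + t *\<^sub>R h x) powr p - norm (g x) powr p\<bar> / \<bar>t\<bar>"
      by (simp add: Q_def)
    also have "\<dots> \<le> W x * \<bar>t\<bar> / \<bar>t\<bar>"
      unfolding W_def by (intro divide_right_mono norm_powr_line_diff_le p that) auto
    finally show ?thesis using False by simp
  qed
  have Qlim: "((\<lambda>t. Q t x) \<longlongrightarrow> p * D x) (at 0)" for x
    using has_real_derivative_norm_powr_line[OF p, of "g x" "h x" 0]
    by (simp add: DERIV_def Q_def D_def)
  have lim: "integrable ?M (\<lambda>x. p * D x) \<and> (\<lambda>n. LINT x|?M. Q (X n) x) \<longlonglongrightarrow> (LINT x|?M. p * D x)"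
    if X: "\<And>n. X n \<in> {-1..1} - {0}" "X \<longlonglongrightarrow> 0" for X :: "nat \<Rightarrow> real"
  proof -
    have ae: "AE x in ?M. (\<lambda>n. Q (X n) x) \<longlonglongrightarrow> p * D x"
    proof (rule AE_I2)
      fix x
      have "filterlim X (at 0) sequentially"
        using X by (auto simp: filterlim_at)
      then show "(\<lambda>n. Q (X n) x) \<longlonglongrightarrow> p * D x"
        by (rule filterlim_compose[OF Qlim])
    qed
    have bd: "AE x in ?M. norm (Q (X n) x) \<le> W x" for n
      using X(1)[of n] by (intro AE_I2 Qb) auto
    show ?thesis
      using integrable_dominated_convergence[OF DM QM W ae bd]
        integral_dominated_convergence[OF DM QM W ae bd] by blast
  qed
  have "(\<lambda>n. 1 / real (Suc n)) \<longlonglongrightarrow> 0"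
    by (rule lim_1_over_n[THEN LIMSEQ_Suc])
  \<comment> \<open>Dominated convergence along this one sequence serves only to extract
    integrability of the limit.\<close>
  then have "integrable ?M (\<lambda>x. p * D x)"
    by (intro conjunct1[OF lim[of "\<lambda>n. 1 / real (Suc n)"]]) (auto simp: field_simps)
  then show "integrable ?M (\<lambda>x. norm (g x) powr (p - 2) * (g x \<bullet> h x))"
    using p by (simp add: D_def[abs_def])
  have "((\<lambda>t. LINT x|?M. Q t x) \<longlongrightarrow> (LINT x|?M. p * D x)) (at 0 within {-1..1})"
    unfolding tendsto_at_iff_sequentially
    using lim by (auto simp: o_def)
  then have L: "((\<lambda>t. LINT x|?M. Q t x) \<longlongrightarrow> (LINT x|?M. p * D x)) (at 0)"
    by (subst (asm) at_within_interior) auto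
  have "(LINT x|?M. Q t x) = (Lp_mass \<Omega> p (\<lambda>x. g x + (0 + t) *\<^sub>R h x) - Lp_mass \<Omega> p (\<lambda>x. g x + 0 *\<^sub>R h x)) / t" for t
  proof -
    have "in_Lp \<Omega> p (\<lambda>x. g x + t *\<^sub>R h x)"
      using in_Lp_lincomb[OF g h, of 1 t] p by simp
    then have "integrable ?M (\<lambda>x. norm (g x + t *\<^sub>R h x) powr p)" "integrable ?M (\<lambda>x. norm (g x) powr p)"
      using g by (auto simp: in_Lp_def)
    then show ?thesis
      unfolding Q_def Lp_mass_def by simp
  qed
  then show "((\<lambda>t. Lp_mass \<Omega> p (\<lambda>x. g x + t *\<^sub>R h x)) has_real_derivative
      p * (LINT x|?M. norm (g x) powr (p - 2) * (g x \<bullet> h x))) (at 0)"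
    using L unfolding DERIV_def by (simp add: D_def)
qed

text \<open>The r-th power is at most 1 plus the m-th power, and constants are integrable over a
  bounded set. Membership in \<open>X_space\<close> controls the gradient only in the larger of the
  two exponents.\<close>

lemma in_Lp_mono_exponent:
  assumes "open \<Omega>" "bounded \<Omega>" "in_Lp \<Omega> m f" "0 < r" "r \<le> m"
  shows "in_Lp \<Omega> r f"
proof -
  have [measurable]: "f \<in> borel_measurable (lebesgue_on \<Omega>)" using assms(3) by (simp add: in_Lp_def)
  have "in_Lp \<Omega> 1 (\<lambda>_. 1 :: real)"
    by (rule in_Lp_bounded_continuous[OF assms(1,2)]) auto
  then have i: "integrable (lebesgue_on \<Omega>) (\<lambda>x. 1 + norm (f x) powr m)"
    using assms(3) unfolding in_Lp_def by (intro Bochner_Integration.integrable_add) auto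
  have "integrable (lebesgue_on \<Omega>) (\<lambda>x. norm (f x) powr r)"
  proof (rule Bochner_Integration.integrable_bound[OF i])
    show "(\<lambda>x. norm (f x) powr r) \<in> borel_measurable (lebesgue_on \<Omega>)" by measurable
    show "AE x in lebesgue_on \<Omega>. norm (norm (f x) powr r) \<le> norm (1 + norm (f x) powr m)"
    proof (rule AE_I2)
      fix x
      have "norm (f x) powr r \<le> 1 + norm (f x) powr m"
      proof (cases "norm (f x) \<le> 1")
        case True
        then have "norm (f x) powr r \<le> 1" using assms(4) by (intro powr_le1) auto
        then show ?thesis by (simp add: add_increasing2)
      next
        case False
        then have "norm (f x) powr r \<le> norm (f x) powr m" using assms(5) by (intro powr_mono) auto
        then show ?thesis by simp
      qed
      then show "norm (norm (f x) powr r) \<le> norm (1 + norm (f x) powr m)" by simp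
    qed
  qed
  then show ?thesis by (simp add: in_Lp_def)
qed

section \<open>The space \<open>X_space\<close> and its sup norm\<close>

lemma X_space_lincomb:
  fixes p q :: real
  assumes "open \<Omega>" "bounded \<Omega>" "max p q > 0" "u \<in> X_space \<Omega> p q" "v \<in> X_space \<Omega> p q"
  shows "(\<lambda>x. \<alpha> * u x + \<beta> * v x) \<in> X_space \<Omega> p q"
  using assms W01_lincomb[OF assms(1,2) _ _ assms(3)]
  unfolding X_space_def by (auto intro!: continuous_intros)

lemma X_space_attains_Linf_norm:
  fixes \<Omega> :: "'a::euclidean_space set" and p q :: real
  assumes "open \<Omega>" "bounded \<Omega>" "\<Omega> \<noteq> {}" "max p q > DIM('a)" "u \<in> X_space \<Omega> p q"
  obtains x where "x \<in> \<Omega>" "\<bar>u x\<bar> = Linf_norm \<Omega> u"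
proof -
  have u: "u \<in> W01 \<Omega> (max p q)" "continuous_on (closure \<Omega>) u"
    using assms(5) by (auto simp: X_space_def)
  note le = Linf_norm_le[OF assms(1,3,2) u(2)] and ge = Linf_norm_ge[OF assms(1,3,2) u(2)]
  have "compact (closure \<Omega>)" "closure \<Omega> \<noteq> {}" using assms(2,3) by auto
  moreover have "continuous_on (closure \<Omega>) (\<lambda>x. \<bar>u x\<bar>)" using u(2) by (intro continuous_intros)
  ultimately obtain x1 where x1: "x1 \<in> closure \<Omega>" "\<forall>y\<in>closure \<Omega>. \<bar>u y\<bar> \<le> \<bar>u x1\<bar>"
    using continuous_attains_sup by metis
  have up: "Linf_norm \<Omega> u \<le> \<bar>u x1\<bar>"
    by (rule le) (use x1(2) closure_subset in blast)
  show ?thesis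
  proof (cases "x1 \<in> \<Omega>")
    case True
    then show ?thesis using that[OF True] up ge[OF True] by simp
  next
    case False
    \<comment> \<open>A maximum on the frontier is 0, so then u vanishes throughout and any point of
      \<open>\<Omega>\<close> will do.\<close>
    then have "x1 \<in> frontier \<Omega>" using x1(1) assms(1) by (simp add: frontier_def interior_open)
    then have "u x1 = 0" by (rule W01_eq_0_frontier[OF assms(1,2,4) u])
    moreover obtain x0 where x0: "x0 \<in> \<Omega>" using assms(3) by blast
    ultimately show ?thesis using that[OF x0] up ge[OF x0] by simp
  qed
qed

lemma Linf_norm_scale:
  assumes "open \<Omega>" "bounded \<Omega>" "\<Omega> \<noteq> {}" "continuous_on (closure \<Omega>) w" "c > 0"
  shows "Linf_norm \<Omega> (\<lambda>x. c * w x) = c * Linf_norm \<Omega> w"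
proof (rule antisym)
  have cw: "continuous_on (closure \<Omega>) (\<lambda>x. c * w x)" by (intro continuous_intros assms(4))
  show "Linf_norm \<Omega> (\<lambda>x. c * w x) \<le> c * Linf_norm \<Omega> w"
    by (rule Linf_norm_le[OF assms(1,3,2) cw])
      (use Linf_norm_ge[OF assms(1,3,2,4)] assms(5) in \<open>simp add: abs_mult\<close>)
  have "Linf_norm \<Omega> w \<le> Linf_norm \<Omega> (\<lambda>x. c * w x) / c"
  proof (rule Linf_norm_le[OF assms(1,3,2,4)])
    fix x assume "x \<in> \<Omega>"
    then show "\<bar>w x\<bar> \<le> Linf_norm \<Omega> (\<lambda>x. c * w x) / c"
      using Linf_norm_ge[OF assms(1,3,2) cw, of x] assms(5) by (simp add: abs_mult field_simps)
  qed
  then show "c * Linf_norm \<Omega> w \<le> Linf_norm \<Omega> (\<lambda>x. c * w x)"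
    using assms(5) by (simp add: field_simps)
qed

section \<open>Minimizers are weak solutions\<close>

text \<open>The first variation in direction v of 1/r times the r-integral of the gradient of u; the
  left side of the weak equation is the sum of two such terms.\<close>

definition flux ::
    "'a::euclidean_space set \<Rightarrow> real \<Rightarrow> ('a \<Rightarrow> real) \<Rightarrow> ('a \<Rightarrow> real) \<Rightarrow> real" where
  "flux \<Omega> r u v = (LINT x|lebesgue_on \<Omega>. norm (weak_grad \<Omega> u x) powr (r - 2) * (weak_grad \<Omega> u x \<bullet> weak_grad \<Omega> v x))"

lemma X_spaceD:
  fixes p q :: real
  assumes "open \<Omega>" "bounded \<Omega>" "u \<in> X_space \<Omega> p q"
  shows "u \<in> W1 \<Omega> (max p q)" "continuous_on (closure \<Omega>) u"
    and "0 < r \<Longrightarrow> r \<le> max p q \<Longrightarrow> in_Lp \<Omega> r (weak_grad \<Omega> u)"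
proof -
  show W: "u \<in> W1 \<Omega> (max p q)" and "continuous_on (closure \<Omega>) u"
    using assms(3) W01_imp_W1 by (auto simp: X_space_def)
  show "in_Lp \<Omega> r (weak_grad \<Omega> u)" if "0 < r" "r \<le> max p q"
    by (rule in_Lp_mono_exponent[OF assms(1,2) W1D(3)[OF assms(1) W] that])
qed

lemma
  fixes p q :: real
  assumes "open \<Omega>" "bounded \<Omega>" "u \<in> X_space \<Omega> p q" "v \<in> X_space \<Omega> p q" "1 < r" "r \<le> max p q"
  shows integrable_flux: "integrable (lebesgue_on \<Omega>)
      (\<lambda>x. norm (weak_grad \<Omega> u x) powr (r - 2) * (weak_grad \<Omega> u x \<bullet> weak_grad \<Omega> v x))"
    and has_real_derivative_gradient_mass:
      "((\<lambda>t. Lp_mass \<Omega> r (weak_grad \<Omega> (\<lambda>x. 1 * u x + t * v x))) has_real_derivative r * flux \<Omega> r u v) (at 0)"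
proof -
  have r0: "0 < r" using assms(5) by simp
  note gu = X_spaceD(3)[OF assms(1,2,3) r0 assms(6)] and gv = X_spaceD(3)[OF assms(1,2,4) r0 assms(6)]
  show "integrable (lebesgue_on \<Omega>)
      (\<lambda>x. norm (weak_grad \<Omega> u x) powr (r - 2) * (weak_grad \<Omega> u x \<bullet> weak_grad \<Omega> v x))"
    by (rule integrable_Lp_mass_derivative[OF gu gv assms(5)])
  \<comment> \<open>The factor 1 makes u + t v a literal instance of the lemmas on linear
    combinations.\<close>
  have "(\<lambda>t. Lp_mass \<Omega> r (weak_grad \<Omega> (\<lambda>x. 1 * u x + t * v x))) =
      (\<lambda>t. Lp_mass \<Omega> r (\<lambda>x. weak_grad \<Omega> u x + t *\<^sub>R weak_grad \<Omega> v x))"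
    using Lp_mass_weak_grad_lincomb[OF assms(1) X_spaceD(1)[OF assms(1-3)] X_spaceD(1)[OF assms(1,2,4)], of r 1]
    by simp
  then show "((\<lambda>t. Lp_mass \<Omega> r (weak_grad \<Omega> (\<lambda>x. 1 * u x + t * v x))) has_real_derivative r * flux \<Omega> r u v) (at 0)"
    using has_real_derivative_Lp_mass[OF gu gv assms(5)] by (simp only: flux_def)
qed

lemma weak_solutionI:
  fixes p q :: real
  assumes "open \<Omega>" "bounded \<Omega>" "1 < p" "1 < q" "u \<in> X_space \<Omega> p q" "x \<in> \<Omega>" "\<bar>u x\<bar> = Linf_norm \<Omega> u"
    and "\<And>v. v \<in> X_space \<Omega> p q \<Longrightarrow>
      flux \<Omega> p u v + flux \<Omega> q u v = lam * (\<bar>u x\<bar> powr (p - 2) * (u x * v x))"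
  shows "weak_solution \<Omega> p q lam u"
  unfolding weak_solution_def
proof (intro conjI bexI[of _ x] ballI assms(5-7))
  fix v assume v: "v \<in> X_space \<Omega> p q"
  have "(LINT x|lebesgue_on \<Omega>.
      (norm (weak_grad \<Omega> u x) powr (p - 2) + norm (weak_grad \<Omega> u x) powr (q - 2)) *
      (weak_grad \<Omega> u x \<bullet> weak_grad \<Omega> v x)) = flux \<Omega> p u v + flux \<Omega> q u v"
    unfolding flux_def distrib_right
    using assms(3,4)
    by (intro Bochner_Integration.integral_add integrable_flux[OF assms(1,2,5) v]) auto
  then show "(LINT x|lebesgue_on \<Omega>.
      (norm (weak_grad \<Omega> u x) powr (p - 2) + norm (weak_grad \<Omega> u x) powr (q - 2)) *
      (weak_grad \<Omega> u x \<bullet> weak_grad \<Omega> v x)) = lam * \<bar>u x\<bar> powr (p - 2) * u x * v x"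
    using assms(8)[OF v] by simp
qed

lemma energy_eq:
  assumes "p > 0" "q > 0"
  shows "energy \<Omega> p q lam w = Lp_mass \<Omega> p (weak_grad \<Omega> w) / p + Lp_mass \<Omega> q (weak_grad \<Omega> w) / q -
    lam / p * Linf_norm \<Omega> w powr p"
  unfolding energy_def using assms by (simp add: Lp_norm_powr)

lemma has_real_derivative_abs_powr_line:
  fixes a b p :: real
  assumes "p > 1"
  shows "((\<lambda>t. \<bar>1 * a + t * b\<bar> powr p) has_real_derivative p * (\<bar>a\<bar> powr (p - 2) * (a * b))) (at 0)"
  using has_real_derivative_norm_powr_line[OF assms, of a b 0] by simp

text \<open>The sup norm is not differentiable, but it is bounded below by the value at the maximum point
  of \<open>u\<close>, with equality at \<open>u\<close>. Replacing it by that value keeps \<open>t = 0\<close> a minimum and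
  makes the energy along \<open>u + t v\<close> differentiable.\<close>

lemma weak_solution_of_minimizer:
  fixes \<Omega> :: "'a::euclidean_space set" and p q :: real
  assumes \<Omega>: "open \<Omega>" "bounded \<Omega>" "\<Omega> \<noteq> {}" and pq: "DIM('a) < p" "p < q"
    and u: "u \<in> X_space \<Omega> p q"
    and min: "\<And>v. v \<in> X_space \<Omega> p q \<Longrightarrow> energy \<Omega> p q lam u \<le> energy \<Omega> p q lam v"
  shows "weak_solution \<Omega> p q lam u"
proof -
  have "real DIM('a) \<ge> 1" by (simp add: Suc_leI)
  then have p1: "1 < p" and q1: "1 < q" using pq by linarith+
  have mx: "max p q > DIM('a)" "max p q > 0" "p \<le> max p q" "q \<le> max p q" using pq p1 by auto
  obtain x where x: "x \<in> \<Omega>" "\<bar>u x\<bar> = Linf_norm \<Omega> u"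
    using X_space_attains_Linf_norm[OF \<Omega> mx(1) u] by metis
  show ?thesis
  proof (rule weak_solutionI[OF \<Omega>(1,2) p1 q1 u x])
    fix v assume v: "v \<in> X_space \<Omega> p q"
    define w where "w t = (\<lambda>x. 1 * u x + t * v x)" for t :: real
    define A where "A t = Lp_mass \<Omega> p (weak_grad \<Omega> (w t))" for t
    define B where "B t = Lp_mass \<Omega> q (weak_grad \<Omega> (w t))" for t
    define c where "c t = \<bar>w t x\<bar> powr p" for t
    have w0: "w 0 = u" by (simp add: w_def)
    have wX: "w t \<in> X_space \<Omega> p q" for t
      unfolding w_def by (rule X_space_lincomb[OF \<Omega>(1,2) mx(2) u v])
    have A': "(A has_real_derivative p * flux \<Omega> p u v) (at 0)"
      unfolding A_def[abs_def] w_def by (rule has_real_derivative_gradient_mass[OF \<Omega>(1,2) u v p1 mx(3)])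
    have B': "(B has_real_derivative q * flux \<Omega> q u v) (at 0)"
      unfolding B_def[abs_def] w_def by (rule has_real_derivative_gradient_mass[OF \<Omega>(1,2) u v q1 mx(4)])
    have c': "(c has_real_derivative p * (\<bar>u x\<bar> powr (p - 2) * (u x * v x))) (at 0)"
      unfolding c_def[abs_def] w_def by (rule has_real_derivative_abs_powr_line[OF p1])
    have en: "energy \<Omega> p q lam (w t) = A t / p + B t / q - lam / p * Linf_norm \<Omega> (w t) powr p" for t
      unfolding A_def B_def using p1 q1 by (intro energy_eq) auto
    have nn: "A t \<ge> 0" "B t \<ge> 0" for t
      by (simp_all add: A_def B_def Lp_mass_nonneg)
    show "flux \<Omega> p u v + flux \<Omega> q u v = lam * (\<bar>u x\<bar> powr (p - 2) * (u x * v x))"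
    proof (cases "lam \<ge> 0")
      case True
      define f where "f t = A t / p + B t / q - lam / p * c t" for t
      have "(f has_real_derivative p * flux \<Omega> p u v / p + q * flux \<Omega> q u v / q -
          lam / p * (p * (\<bar>u x\<bar> powr (p - 2) * (u x * v x)))) (at 0)"
        unfolding f_def[abs_def] by (intro DERIV_diff DERIV_add DERIV_cdivide DERIV_cmult A' B' c')
      then have f': "(f has_real_derivative flux \<Omega> p u v + flux \<Omega> q u v -
          lam * (\<bar>u x\<bar> powr (p - 2) * (u x * v x))) (at 0)"
        using p1 q1 by simp
      have "f 0 \<le> f t" for t
      proof -
        have "f 0 = energy \<Omega> p q lam u"
          using en[of 0] x(2) by (simp add: f_def w0 c_def)
        also have "\<dots> \<le> energy \<Omega> p q lam (w t)" by (rule min[OF wX])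
        also have "\<dots> \<le> f t"
        proof -
          have "c t \<le> Linf_norm \<Omega> (w t) powr p"
            unfolding c_def using p1 Linf_norm_ge[OF \<Omega>(1,3,2) X_spaceD(2)[OF \<Omega>(1,2) wX] x(1)]
            by (intro powr_mono2) auto
          then have "lam / p * c t \<le> lam / p * Linf_norm \<Omega> (w t) powr p"
            using True p1 by (intro mult_left_mono) auto
          then show ?thesis by (simp add: en f_def)
        qed
        finally show ?thesis .
      qed
      then have "flux \<Omega> p u v + flux \<Omega> q u v - lam * (\<bar>u x\<bar> powr (p - 2) * (u x * v x)) = 0"
        by (intro DERIV_local_min[OF f' zero_less_one]) simp
      then show ?thesis by simp
    next
      case False
      \<comment> \<open>For negative \<open>lam\<close> the comparison through \<open>c\<close>
        points the wrong way. Comparison with the zero function shows instead that the energy of u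
        is at most 0, while its three terms are nonnegative: \<open>A 0\<close>, \<open>B 0\<close>
        and \<open>u x\<close> vanish, and \<open>A\<close> and \<open>B\<close> are themselves
        minimal at 0. The zero function is spelled as a combination of u with itself so that the
        lemmas on linear combinations cover it.\<close>
      have zX: "(\<lambda>x. 0 * u x + 0 * u x) \<in> X_space \<Omega> p q"
        by (rule X_space_lincomb[OF \<Omega>(1,2) mx(2) u u])
      have z: "Lp_mass \<Omega> r (weak_grad \<Omega> (\<lambda>x. 0 * u x + 0 * u x)) = 0" for r
        unfolding Lp_mass_weak_grad_lincomb[OF \<Omega>(1) X_spaceD(1)[OF \<Omega>(1,2) u] X_spaceD(1)[OF \<Omega>(1,2) u]]
        by (simp add: Lp_mass_def)
      have "Linf_norm \<Omega> (\<lambda>x. 0 * u x + 0 * u x) \<le> 0"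
        by (rule Linf_norm_le[OF \<Omega>(1,3,2) X_spaceD(2)[OF \<Omega>(1,2) zX]]) simp
      then have "Linf_norm \<Omega> (\<lambda>x. 0 * u x + 0 * u x) = 0"
        using Linf_norm_ge[OF \<Omega>(1,3,2) X_spaceD(2)[OF \<Omega>(1,2) zX] x(1)] by simp
      then have "energy \<Omega> p q lam (\<lambda>x. 0 * u x + 0 * u x) = 0"
        using z p1 q1 by (subst energy_eq) auto
      then have "A 0 / p + B 0 / q - lam / p * \<bar>u x\<bar> powr p \<le> 0"
        using min[OF zX] en[of 0] x(2) by (simp add: w0)
      moreover have "- (lam / p * \<bar>u x\<bar> powr p) \<ge> 0"
        using False p1 by (simp add: mult_nonpos_nonneg divide_nonpos_pos)
      moreover have "A 0 / p \<ge> 0" "B 0 / q \<ge> 0" using nn p1 q1 by auto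
      ultimately have "A 0 / p = 0" "B 0 / q = 0" "lam / p * \<bar>u x\<bar> powr p = 0" by linarith+
      then have zero: "A 0 = 0" "B 0 = 0" "u x = 0" using p1 q1 False by auto
      have "p * flux \<Omega> p u v = 0"
        by (rule DERIV_local_min[OF A' zero_less_one]) (use zero nn in simp)
      moreover have "q * flux \<Omega> q u v = 0"
        by (rule DERIV_local_min[OF B' zero_less_one]) (use zero nn in simp)
      ultimately show ?thesis using p1 q1 zero by simp
    qed
  qed
qed

text \<open>A direction \<open>w\<close> with \<open>lam * \<parallel>w\<parallel>\<^sup>p > \<parallel>\<nabla>w\<parallel>\<^sup>p\<close> is rescaled onto the Nehari set by a unique factor.
  On that set the energy is a positive multiple of the \<open>q\<close>-part, so minimality of \<open>u\<close> becomes the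
  inequality below, which is free of the scaling factor.\<close>

lemma nehari_minimizer_inequality:
  fixes \<Omega> :: "'a::euclidean_space set" and p q :: real
  assumes \<Omega>: "open \<Omega>" "bounded \<Omega>" "\<Omega> \<noteq> {}" and pq: "0 < q" "q < p"
    and u: "u \<in> nehari \<Omega> p q lam"
    and min: "\<And>v. v \<in> nehari \<Omega> p q lam \<Longrightarrow> energy \<Omega> p q lam u \<le> energy \<Omega> p q lam v"
    and w: "w \<in> X_space \<Omega> p q"
    and a_def: "a = Lp_mass \<Omega> p (weak_grad \<Omega> w)" and b_def: "b = Lp_mass \<Omega> q (weak_grad \<Omega> w)"
    and S_def: "S = lam * Linf_norm \<Omega> w powr p - a"
    and pos: "b > 0" "S > 0"
  shows "Lp_mass \<Omega> q (weak_grad \<Omega> u) powr (p - q) * S powr q \<le> b powr p"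
proof -
  have p0: "p > 0" using pq by simp
  have mx: "max p q > 0" using p0 by simp
  note wc = X_spaceD(2)[OF \<Omega>(1,2) w] and wW = X_spaceD(1)[OF \<Omega>(1,2) w]
  \<comment> \<open>The positive solution of \<tau>^p S = \<tau>^q b, which is the Nehari identity
    for \<tau> w.\<close>
  define \<tau> where "\<tau> = (b / S) powr (1 / (p - q))"
  have \<tau>: "\<tau> > 0" using pos by (simp add: \<tau>_def)
  have \<tau>_eq: "\<tau> powr (p - q) = b / S" using pos pq by (simp add: \<tau>_def powr_powr)
  define z where "z = (\<lambda>x. \<tau> * w x + 0 * w x)"
  have zX: "z \<in> X_space \<Omega> p q"
    unfolding z_def by (rule X_space_lincomb[OF \<Omega>(1,2) mx w w])
  have mass: "Lp_mass \<Omega> r (weak_grad \<Omega> z) = \<tau> powr r * Lp_mass \<Omega> r (weak_grad \<Omega> w)"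
    if "0 < r" "r \<le> max p q" for r
    unfolding z_def Lp_mass_weak_grad_lincomb[OF \<Omega>(1) wW wW]
    using Lp_mass_scale[OF X_spaceD(3)[OF \<Omega>(1,2) w that], of \<tau>] \<tau> by simp
  have mp: "Lp_mass \<Omega> p (weak_grad \<Omega> z) = \<tau> powr p * a" and mq: "Lp_mass \<Omega> q (weak_grad \<Omega> z) = \<tau> powr q * b"
    using mass[of p] mass[of q] pq p0 by (auto simp: a_def b_def)
  have Lz: "Linf_norm \<Omega> z powr p = \<tau> powr p * Linf_norm \<Omega> w powr p"
    using Linf_norm_scale[OF \<Omega> wc \<tau>] by (simp add: z_def powr_mult)
  have "\<tau> powr p * S = \<tau> powr q * (\<tau> powr (p - q) * S)"
    by (simp flip: powr_add mult.assoc)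
  also have "\<dots> = \<tau> powr q * b" using \<tau>_eq pos by simp
  finally have neh: "\<tau> powr p * a + \<tau> powr q * b = lam * (\<tau> powr p * Linf_norm \<Omega> w powr p)"
    unfolding S_def by (simp add: algebra_simps)
  \<comment> \<open>Otherwise w would vanish on \<open>\<Omega>\<close> and S would be -a, which is
    not positive.\<close>
  have "\<not> null_function \<Omega> z"
  proof
    assume "null_function \<Omega> z"
    then have "AE y in lebesgue_on \<Omega>. \<bar>w y\<bar> \<le> 0"
      unfolding null_function_def by (rule eventually_mono) (use \<tau> in \<open>simp add: z_def\<close>)
    then have "\<bar>w y\<bar> \<le> 0" if "y \<in> \<Omega>" for y
      by (rule continuous_AE_le[OF \<Omega>(1) continuous_on_subset[OF wc closure_subset] _ that])
    then have "Linf_norm \<Omega> w \<le> 0"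
      by (rule Linf_norm_le[OF \<Omega>(1,3,2) wc])
    moreover have "Linf_norm \<Omega> w \<ge> 0"
      using Linf_norm_ge[OF \<Omega>(1,3,2) wc] \<Omega>(3) by (meson abs_ge_zero ex_in_conv order_trans)
    ultimately have "S = - a" by (simp add: S_def)
    then show False using pos(2) Lp_mass_nonneg[of \<Omega> p "weak_grad \<Omega> w"] by (simp add: a_def)
  qed
  then have zN: "z \<in> nehari \<Omega> p q lam"
    using zX neh mp mq Lz p0 pq(1) by (simp add: nehari_def Lp_norm_powr)
  have en: "energy \<Omega> p q lam y = (1 / q - 1 / p) * Lp_mass \<Omega> q (weak_grad \<Omega> y)"
    if "y \<in> nehari \<Omega> p q lam" for y
  proof -
    have "Lp_mass \<Omega> p (weak_grad \<Omega> y) + Lp_mass \<Omega> q (weak_grad \<Omega> y) = lam * Linf_norm \<Omega> y powr p"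
      using that p0 pq(1) by (simp add: nehari_def Lp_norm_powr)
    then have "lam / p * Linf_norm \<Omega> y powr p = (Lp_mass \<Omega> p (weak_grad \<Omega> y) + Lp_mass \<Omega> q (weak_grad \<Omega> y)) / p"
      by simp
    then show ?thesis
      using p0 pq(1) by (simp add: energy_eq add_divide_distrib left_diff_distrib)
  qed
  have "1 / q - 1 / p > 0" using pq by (simp add: frac_less2)
  then have le: "Lp_mass \<Omega> q (weak_grad \<Omega> u) \<le> \<tau> powr q * b"
    using min[OF zN] unfolding en[OF zN] en[OF u] mq by simp
  \<comment> \<open>Raising to the power p - q removes the root in \<open>\<tau>\<close>: the q-th
    power of \<tau>^(p-q) is (b/S)^q.\<close>
  have "Lp_mass \<Omega> q (weak_grad \<Omega> u) powr (p - q) \<le> (\<tau> powr q * b) powr (p - q)"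
    using le pq by (intro powr_mono2 Lp_mass_nonneg) auto
  also have "\<dots> = (\<tau> powr (p - q)) powr q * b powr (p - q)"
    by (simp add: powr_mult powr_powr mult.commute)
  also have "\<dots> = b powr q * b powr (p - q) / S powr q"
    unfolding \<tau>_eq using pos by (simp add: powr_divide)
  also have "b powr q * b powr (p - q) = b powr p"
    by (simp flip: powr_add)
  finally show ?thesis using pos(2) by (simp add: field_simps)
qed

text \<open>The inequality just proved is an equality at w = u, because S = b there by the Nehari
  identity. It survives replacing the sup norm of u + t v by the value at \<open>x\<close>, as long
  as the resulting smaller S stays positive, which continuity ensures near t = 0.\<close>

lemma weak_solution_of_nehari_minimizer:
  fixes \<Omega> :: "'a::euclidean_space set" and p q :: real
  assumes \<Omega>: "open \<Omega>" "bounded \<Omega>" "\<Omega> \<noteq> {}" and pq: "DIM('a) < q" "q < p"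
    and u: "u \<in> nehari \<Omega> p q lam"
    and min: "\<And>v. v \<in> nehari \<Omega> p q lam \<Longrightarrow> energy \<Omega> p q lam u \<le> energy \<Omega> p q lam v"
  shows "weak_solution \<Omega> p q lam u"
proof -
  have "real DIM('a) \<ge> 1" by (simp add: Suc_leI)
  then have p1: "1 < p" and q1: "1 < q" using pq by linarith+
  have mx: "max p q > DIM('a)" "max p q > 0" "p \<le> max p q" "q \<le> max p q" "max p q = p"
    using pq p1 by auto
  have uX: "u \<in> X_space \<Omega> p q" and nn: "\<not> null_function \<Omega> u"
    using u by (auto simp: nehari_def)
  have u_eq: "Lp_mass \<Omega> p (weak_grad \<Omega> u) + Lp_mass \<Omega> q (weak_grad \<Omega> u) = lam * Linf_norm \<Omega> u powr p"
    using u p1 q1 by (simp add: nehari_def Lp_norm_powr)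
  note uc = X_spaceD(2)[OF \<Omega>(1,2) uX]
  obtain x where x: "x \<in> \<Omega>" "\<bar>u x\<bar> = Linf_norm \<Omega> u"
    using X_space_attains_Linf_norm[OF \<Omega> mx(1) uX] by metis
  define b0 where "b0 = Lp_mass \<Omega> q (weak_grad \<Omega> u)"
  \<comment> \<open>If the gradient vanished almost everywhere, Morrey's bound would hold with every
    positive \<open>G\<close> and force u = 0, which the Nehari set excludes. Positivity is needed
    to differentiate powers of \<open>B\<close> and \<open>S\<close> at 0 and to cancel at the
    end.\<close>
  have b0: "b0 > 0"
  proof (rule ccontr)
    assume "\<not> b0 > 0"
    then have "b0 = 0" using Lp_mass_nonneg[of \<Omega> q "weak_grad \<Omega> u"] by (simp add: b0_def)
    moreover have "integrable (lebesgue_on \<Omega>) (\<lambda>x. norm (weak_grad \<Omega> u x) powr q)"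
      using X_spaceD(3)[OF \<Omega>(1,2) uX, of q] q1 mx(4) by (simp add: in_Lp_def)
    ultimately have "AE x in lebesgue_on \<Omega>. norm (weak_grad \<Omega> u x) powr q = 0"
      unfolding b0_def Lp_mass_def by (subst (asm) integral_nonneg_eq_0_iff_AE) auto
    then have "AE x in lebesgue_on \<Omega>. norm (weak_grad \<Omega> u x) powr p = 0"
      by (rule eventually_mono) simp
    then have a0: "Lp_mass \<Omega> p (weak_grad \<Omega> u) = 0"
      unfolding Lp_mass_def by (rule integral_eq_zero_AE)
    have "DIM('a) < p" using pq by linarith
    then obtain C where C: "C > 0"
      "\<And>w G x. w \<in> W01 \<Omega> p \<Longrightarrow> continuous_on \<Omega> w \<Longrightarrow> G > 0 \<Longrightarrow>
         2 powr p * Lp_mass \<Omega> p (weak_grad \<Omega> w) < G powr p \<Longrightarrow> x \<in> \<Omega> \<Longrightarrow> \<bar>w x\<bar> \<le> C * G"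
      using morrey_W01[OF \<Omega>(1,2), of p] by metis
    have "u y = 0" if y: "y \<in> \<Omega>" for y
    proof (rule ccontr)
      assume "u y \<noteq> 0"
      then have G: "\<bar>u y\<bar> / (2 * C) > 0" using C(1) by simp
      have "u \<in> W01 \<Omega> p" using uX mx(5) by (simp add: X_space_def)
      then have "\<bar>u y\<bar> \<le> C * (\<bar>u y\<bar> / (2 * C))"
        using a0 G by (intro C(2) continuous_on_subset[OF uc closure_subset] y) auto
      then show False using C(1) \<open>u y \<noteq> 0\<close> by simp
    qed
    then have "null_function \<Omega> u"
      unfolding null_function_def by (intro AE_I2) simp
    then show False using nn by simp
  qed
  have lam: "lam > 0"
  proof (rule ccontr)
    assume "\<not> lam > 0"
    then have "lam * Linf_norm \<Omega> u powr p \<le> 0" by (simp add: mult_nonpos_nonneg)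
    then show False
      using u_eq b0 Lp_mass_nonneg[of \<Omega> p "weak_grad \<Omega> u"] by (simp add: b0_def)
  qed
  show ?thesis
  proof (rule weak_solutionI[OF \<Omega>(1,2) p1 q1 uX x])
    fix v assume v: "v \<in> X_space \<Omega> p q"
    define w where "w t = (\<lambda>x. 1 * u x + t * v x)" for t :: real
    define A where "A t = Lp_mass \<Omega> p (weak_grad \<Omega> (w t))" for t
    define B where "B t = Lp_mass \<Omega> q (weak_grad \<Omega> (w t))" for t
    define c where "c t = \<bar>w t x\<bar> powr p" for t
    define T where "T = \<bar>u x\<bar> powr (p - 2) * (u x * v x)"
    define S where "S t = lam * c t - A t" for t
    have w0: "w 0 = u" by (simp add: w_def)
    have wX: "w t \<in> X_space \<Omega> p q" for t
      unfolding w_def by (rule X_space_lincomb[OF \<Omega>(1,2) mx(2) uX v])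
    have A': "(A has_real_derivative p * flux \<Omega> p u v) (at 0)"
      unfolding A_def[abs_def] w_def by (rule has_real_derivative_gradient_mass[OF \<Omega>(1,2) uX v p1 mx(3)])
    have B': "(B has_real_derivative q * flux \<Omega> q u v) (at 0)"
      unfolding B_def[abs_def] w_def by (rule has_real_derivative_gradient_mass[OF \<Omega>(1,2) uX v q1 mx(4)])
    have c': "(c has_real_derivative p * T) (at 0)"
      unfolding c_def[abs_def] w_def T_def by (rule has_real_derivative_abs_powr_line[OF p1])
    have S': "(S has_real_derivative lam * (p * T) - p * flux \<Omega> p u v) (at 0)"
      unfolding S_def[abs_def] by (intro DERIV_diff DERIV_cmult A' c')
    have B0: "B 0 = b0" by (simp add: B_def w0 b0_def)
    have S0: "S 0 = b0"
      using u_eq x(2) by (simp add: S_def c_def A_def w0 b0_def)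
    \<comment> \<open>Nonnegative near 0 by the inequality, and 0 at t = 0, where both terms equal
      \<open>b0 powr p\<close>.\<close>
    define K where "K t = B t powr p - b0 powr (p - q) * S t powr q" for t
    have K': "(K has_real_derivative p * b0 powr (p - 1) * (q * flux \<Omega> q u v) -
        b0 powr (p - q) * (q * b0 powr (q - 1) * (lam * (p * T) - p * flux \<Omega> p u v))) (at 0)"
      unfolding K_def[abs_def]
      using DERIV_fun_powr[OF B', of p] DERIV_fun_powr[OF S', of q] b0 B0 S0
      by (intro DERIV_diff DERIV_cmult) simp_all
    have "\<forall>\<^sub>F t in nhds 0. B t > 0" "\<forall>\<^sub>F t in nhds 0. S t > 0"
      using order_tendstoD(1)[OF DERIV_isCont[OF B', unfolded isCont_def tendsto_at_iff_tendsto_nhds], of 0]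
        order_tendstoD(1)[OF DERIV_isCont[OF S', unfolded isCont_def tendsto_at_iff_tendsto_nhds], of 0] B0 S0 b0
      by simp_all
    then have "\<forall>\<^sub>F t in nhds 0. B t > 0 \<and> S t > 0" by (rule eventually_conj)
    then obtain d where d: "d > 0" "\<And>t. dist t 0 < d \<Longrightarrow> B t > 0 \<and> S t > 0"
      unfolding eventually_nhds_metric by metis
    have Kmin: "K 0 \<le> K t" if t: "\<bar>0 - t\<bar> < d" for t
    proof -
      have pos: "B t > 0" "S t > 0" using d(2)[of t] t by auto
      \<comment> \<open>The inequality speaks of the true sup norm, that is of \<open>S1\<close>;
        the smaller positive \<open>S t\<close> inherits it since \<open>lam\<close> is positive and
        the q-th power is increasing.\<close>
      define S1 where "S1 = lam * Linf_norm \<Omega> (w t) powr p - A t"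
      have "c t \<le> Linf_norm \<Omega> (w t) powr p"
        unfolding c_def using p1 Linf_norm_ge[OF \<Omega>(1,3,2) X_spaceD(2)[OF \<Omega>(1,2) wX] x(1)]
        by (intro powr_mono2) auto
      then have S1: "S t \<le> S1" unfolding S_def S1_def using lam by simp
      have "b0 powr (p - q) * S t powr q \<le> b0 powr (p - q) * S1 powr q"
        using S1 pos q1 by (intro mult_left_mono powr_mono2) auto
      also have "\<dots> \<le> B t powr p"
        unfolding b0_def
        by (rule nehari_minimizer_inequality[OF \<Omega> _ pq(2) u min wX A_def B_def S1_def pos(1)])
          (use S1 pos q1 in auto)
      finally have "K t \<ge> 0" by (simp add: K_def)
      moreover have "K 0 = 0"
        by (simp add: K_def B0 S0 flip: powr_add)
      ultimately show ?thesis by simp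
    qed
    \<comment> \<open>The powers of \<open>b0\<close> in both terms of the derivative agree, so the
      positive factor p q b0^(p-1) splits off and the weak equation remains.\<close>
    have "b0 powr (p - q) * b0 powr (q - 1) = b0 powr (p - 1)"
      by (simp flip: powr_add)
    then have "p * b0 powr (p - 1) * (q * flux \<Omega> q u v) -
        b0 powr (p - q) * (q * b0 powr (q - 1) * (lam * (p * T) - p * flux \<Omega> p u v)) =
      (p * q * b0 powr (p - 1)) * (flux \<Omega> p u v + flux \<Omega> q u v - lam * T)"
      by (simp add: algebra_simps)
    moreover have "p * b0 powr (p - 1) * (q * flux \<Omega> q u v) -
        b0 powr (p - q) * (q * b0 powr (q - 1) * (lam * (p * T) - p * flux \<Omega> p u v)) = 0"
      by (rule DERIV_local_min[OF K' d(1)]) (use Kmin in simp)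
    ultimately show "flux \<Omega> p u v + flux \<Omega> q u v = lam * (\<bar>u x\<bar> powr (p - 2) * (u x * v x))"
      using p1 q1 b0 by (simp add: T_def)
  qed
qed

theorem proposition3p5:
  fixes \<Omega> :: "(real ^ 'n) set" and p q lam :: real and u :: "real ^ 'n \<Rightarrow> real"
  assumes "CARD('n) \<ge> 2"
    and "smooth_bounded_domain \<Omega>"
    and "p > CARD('n)" and "q > CARD('n)" and "p \<noteq> q"
    and "lam > lambda_inf \<Omega> p"
    and "least_energy_solution \<Omega> p q lam u"
  shows "weak_solution \<Omega> p q lam u"
proof -
  have \<Omega>: "open \<Omega>" "bounded \<Omega>" "\<Omega> \<noteq> {}"
    using assms(2) by (simp_all add: smooth_bounded_domain_def)
  consider
    "p < q" "u \<in> X_space \<Omega> p q" "\<forall>v\<in>X_space \<Omega> p q. energy \<Omega> p q lam u \<le> energy \<Omega> p q lam v" |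
    "q < p" "u \<in> nehari \<Omega> p q lam" "\<forall>v\<in>nehari \<Omega> p q lam. energy \<Omega> p q lam u \<le> energy \<Omega> p q lam v"
    using assms(7) unfolding least_energy_solution_def by blast
  then show ?thesis
  proof cases
    case 1
    then show ?thesis
      using assms(3) by (intro weak_solution_of_minimizer[OF \<Omega>]) simp_all
  next
    case 2
    then show ?thesis
      using assms(4) by (intro weak_solution_of_nehari_minimizer[OF \<Omega>]) simp_all
  qed
qed

end
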